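(* Let the random time process $Y=(Y_t)_{t\ge0}$ be a fractional Brownian motion (with continuous paths, $Y_0=0$) on a probability space $(\Omega',\mathcal{F}',\mathbf{P}')$. Let $M_1$ be a Gaussian random measure on $\Omega'\times\mathbb{R}$ with control measure $\mathbf{P}'\times\mathrm{Lebesgue}$. For $s\ge0$ let $\tau_s=\inf\{t\ge0:Y_t=s\}$, which is almost surely finite. Define the process obtained from $Y^{(\times)}_t=\int_{\Omega'\times\mathbb{R}}1_{[0,Y_t(\omega')]}(x)\,M_1(d\omega'\times dx)$ by time-changing its integral kernel: $$Y^{(\times)_\tau}_t:=\int_{\Omega'\times\mathbb{R}}1_{[0,Y_{\tau_t}(\omega')]}(x)\,M_1(d\omega'\times dx),\qquad t\ge0,$$ where $Y_{\tau_t}(\omega')=Y_{\tau_t(\omega')}(\omega')$. Then $(Y^{(\times)_\tau}_t)_{t\ge0}$ is a Brownian motion.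
   Context: For $a<0$, $[0,a]$ means $[a,0]$. A Gaussian random measure $M_1$ with control measure $m=\mathbf{P}'\times\mathrm{Lebesgue}$ is an independently scattered, $\sigma$-additive random set function, defined on measurable subsets of $\Omega'\times\mathbb{R}$ of finite $m$-measure and living on a probability space $(\Omega,\mathcal{F},\mathbf{P})$ other than $(\Omega',\mathcal{F}',\mathbf{P}')$, with $M_1(A)\sim N(0,m(A))$. This is the case $\alpha=2$ of a symmetric $\alpha$-stable random measure, normalized so that $\int f\,dM_1$ is centered Gaussian with variance $\int f^2\,dm$ for $f\in L^2(m)$. "Is a Brownian motion" is understood in the sense of finite-dimensional distributions, i.e. up to choice of a version. *)

theory Defs
  imports "HOL-Probability.Probability"
begin

(* The normal law with mean \<mu> and variance v. The library's normal_density does not cover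
   the degenerate case v = 0, which is the point mass at \<mu>. *)
definition normal_law :: "real \<Rightarrow> real \<Rightarrow> real measure" where
  "normal_law \<mu> v =
     (if v = 0 then return borel \<mu> else density lborel (normal_density \<mu> (sqrt v)))"

definition centered_gaussian_process ::
    "'a measure \<Rightarrow> 'i set \<Rightarrow> ('i \<Rightarrow> 'a \<Rightarrow> real) \<Rightarrow> bool" where
  "centered_gaussian_process P T X \<longleftrightarrow>
     (\<forall>t\<in>T. X t \<in> borel_measurable P) \<and>
     (\<forall>J c. finite J \<and> J \<subseteq> T \<longrightarrow>
        (\<exists>v\<ge>0. distr P borel (\<lambda>\<omega>. \<Sum>t\<in>J. c t * X t \<omega>) = normal_law 0 v))"

(* Fractional Brownian motion with Hurst parameter H and scale \<sigma> (standard for \<sigma> = 1),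
   indexed by t \<ge> 0; the values Y t for t < 0 are irrelevant. *)
definition fractional_brownian_motion ::
    "'a measure \<Rightarrow> real \<Rightarrow> real \<Rightarrow> (real \<Rightarrow> 'a \<Rightarrow> real) \<Rightarrow> bool" where
  "fractional_brownian_motion P H \<sigma> Y \<longleftrightarrow>
     0 < H \<and> H < 1 \<and> 0 < \<sigma> \<and>
     centered_gaussian_process P {0..} Y \<and>
     (\<forall>s\<ge>0. \<forall>t\<ge>0. (\<integral>\<omega>. Y s \<omega> * Y t \<omega> \<partial>P) =
        \<sigma>\<^sup>2 / 2 * (s powr (2 * H) + t powr (2 * H) - \<bar>t - s\<bar> powr (2 * H))) \<and>
     (\<forall>\<omega>\<in>space P. Y 0 \<omega> = 0 \<and> continuous_on {0..} (\<lambda>t. Y t \<omega>))"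

(* Brownian motion in the sense of finite-dimensional distributions: no path regularity. *)
definition brownian_motion_fdd :: "'a measure \<Rightarrow> (real \<Rightarrow> 'a \<Rightarrow> real) \<Rightarrow> bool" where
  "brownian_motion_fdd P B \<longleftrightarrow>
     (\<forall>t\<ge>0. B t \<in> borel_measurable P) \<and>
     (AE \<omega> in P. B 0 \<omega> = 0) \<and>
     (\<forall>s t. 0 \<le> s \<and> s \<le> t \<longrightarrow>
        distr P borel (\<lambda>\<omega>. B t \<omega> - B s \<omega>) = normal_law 0 (t - s)) \<and>
     (\<forall>(n::nat) t. 0 \<le> t 0 \<and> (\<forall>i<n. t i \<le> t (Suc i)) \<longrightarrow>
        prob_space.indep_vars P (\<lambda>_. borel) (\<lambda>i \<omega>. B (t (Suc i)) \<omega> - B (t i) \<omega>) {..<n})"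

(* W A is meaningful only for measurable A of finite m-measure. *)
definition gaussian_random_measure ::
    "'a measure \<Rightarrow> 'b measure \<Rightarrow> ('b set \<Rightarrow> 'a \<Rightarrow> real) \<Rightarrow> bool" where
  "gaussian_random_measure P m W \<longleftrightarrow>
     (\<forall>A\<in>sets m. emeasure m A < \<infinity> \<longrightarrow>
        W A \<in> borel_measurable P \<and> distr P borel (W A) = normal_law 0 (measure m A)) \<and>
     (\<forall>(n::nat) A. (\<forall>i<n. A i \<in> sets m \<and> emeasure m (A i) < \<infinity>) \<and>
        disjoint_family_on A {..<n} \<longrightarrow>
        prob_space.indep_vars P (\<lambda>_. borel) (\<lambda>i. W (A i)) {..<n}) \<and>
     (\<forall>A :: nat \<Rightarrow> 'b set. range A \<subseteq> sets m \<and> disjoint_family A \<and>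
        emeasure m (\<Union>i. A i) < \<infinity> \<longrightarrow>
        (AE \<omega> in P. (\<lambda>i. W (A i) \<omega>) sums W (\<Union>i. A i) \<omega>))"

(* For a simple function s whose support has finite measure. The level set of y = 0 may have
   infinite measure, but its term vanishes. *)
definition simple_gaussian_integral ::
    "'b measure \<Rightarrow> ('b set \<Rightarrow> 'a \<Rightarrow> real) \<Rightarrow> ('b \<Rightarrow> real) \<Rightarrow> 'a \<Rightarrow> real" where
  "simple_gaussian_integral m W s \<omega> = (\<Sum>y\<in>s ` space m. y * W {z\<in>space m. s z = y} \<omega>)"

(* The integral of f in L^2(m) is the L^2(P)-limit of the integrals of simple functions
   converging to f in L^2(m). The squared distances are taken as nonnegative integrals, since
   the Bochner integral of a non-integrable function would be 0. *)
definition has_gaussian_integral ::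
    "'a measure \<Rightarrow> 'b measure \<Rightarrow> ('b set \<Rightarrow> 'a \<Rightarrow> real) \<Rightarrow> ('b \<Rightarrow> real) \<Rightarrow> ('a \<Rightarrow> real) \<Rightarrow> bool"
  where
  "has_gaussian_integral P m W f I \<longleftrightarrow>
     f \<in> borel_measurable m \<and> I \<in> borel_measurable P \<and>
     (\<exists>s :: nat \<Rightarrow> 'b \<Rightarrow> real.
        (\<forall>n. Bochner_Integration.simple_bochner_integrable m (s n)) \<and>
        (\<lambda>n. \<integral>\<^sup>+z. ennreal ((s n z - f z)\<^sup>2) \<partial>m) \<longlonglongrightarrow> 0 \<and>
        (\<lambda>n. \<integral>\<^sup>+\<omega>. ennreal ((simple_gaussian_integral m W (s n) \<omega> - I \<omega>)\<^sup>2) \<partial>P) \<longlonglongrightarrow> 0)"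

(* The integral is determined only up to P-null sets; an arbitrary version is selected. *)
definition gaussian_integral ::
    "'a measure \<Rightarrow> 'b measure \<Rightarrow> ('b set \<Rightarrow> 'a \<Rightarrow> real) \<Rightarrow> ('b \<Rightarrow> real) \<Rightarrow> 'a \<Rightarrow> real" where
  "gaussian_integral P m W f = (SOME I. has_gaussian_integral P m W f I)"

(* The process t \<mapsto> \<integral> 1_[0, Z_t(\<omega>')](x) W(d\<omega>' \<times> dx). For real a, closed_segment 0 a is [0, a] if
   a \<ge> 0 and [a, 0] if a < 0. *)
definition segment_integral_process ::
    "'a measure \<Rightarrow> 'b measure \<Rightarrow> (('b \<times> real) set \<Rightarrow> 'a \<Rightarrow> real) \<Rightarrow> (real \<Rightarrow> 'b \<Rightarrow> real) \<Rightarrow>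
     real \<Rightarrow> 'a \<Rightarrow> real" where
  "segment_integral_process P P' W Z t =
     gaussian_integral P (P' \<Otimes>\<^sub>M lborel) W
       (\<lambda>(\<omega>', x). indicator (closed_segment 0 (Z t \<omega>')) x)"

(* Infinite if the level s is never reached. *)
definition level_hitting_time :: "(real \<Rightarrow> 'b \<Rightarrow> real) \<Rightarrow> real \<Rightarrow> 'b \<Rightarrow> ereal" where
  "level_hitting_time Y s \<omega> = Inf (ereal ` {t. 0 \<le> t \<and> Y t \<omega> = s})"

(* At an infinite time, real_of_ereal yields the junk value Y 0 \<omega>. *)
definition time_change ::
    "(real \<Rightarrow> 'b \<Rightarrow> real) \<Rightarrow> (real \<Rightarrow> 'b \<Rightarrow> ereal) \<Rightarrow> real \<Rightarrow> 'b \<Rightarrow> real" where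
  "time_change Y \<tau> t \<omega> = Y (real_of_ereal (\<tau> t \<omega>)) \<omega>"

end

theory Submission
  imports Defs
begin

text \<open>
  The time change makes the integration kernel deterministic. A continuous path that reaches the
  level \<open>t\<close> satisfies \<open>Y = t\<close> at the first time it does so, so the time-changed process has the value
  \<open>t\<close> at time \<open>t\<close> on every path that reaches \<open>t\<close>. If almost every path does, the kernel agrees
  almost everywhere with the indicator of the strip \<open>\<Omega>' \<times> [0, t]\<close>, and its integral is the random
  measure of that strip. Increments over disjoint intervals are then the masses of the disjoint
  strips \<open>\<Omega>' \<times> (s, t]\<close>, which are independent, and normal with variance \<open>t - s\<close>
  (\<open>brownian_motion_fdd_of_strips\<close>). The dependence of the increments of \<open>Y\<close> has disappeared.

  Two points need work. The first is that fractional Brownian motion reaches each level almost surely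
  (\<open>fractional_brownian_motion_hits_level\<close>). By self-similarity, \<open>Y\<close> sampled along a geometric
  sequence of times and normalized is a sequence of standard normal variables \<open>Z\<^sub>k\<close> whose
  correlations are nonnegative and uniformly small when the ratio of the times is large. A law of large
  numbers in \<open>L\<^sup>2\<close> says that the mean of the \<open>Z\<^sub>k\<close> is close to \<open>0\<close> while the mean of
  \<open>1 - cos Z\<^sub>k\<close> is close to \<open>1 - exp (-1/2) > 0\<close>. Were \<open>Y\<close> to stay below a fixed level, all \<open>Z\<^sub>k\<close>
  would be below a small \<open>\<epsilon>\<close>, and then \<open>1 - cos Z\<^sub>k \<le> \<bar>Z\<^sub>k\<bar> \<le> 2 * \<epsilon> - Z\<^sub>k\<close>; averaging gives a contradiction.

  The second is that the integral is specified only as some \<open>L\<^sup>2\<close>-limit of integrals of simple functions.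
  An isometry between simple functions and their integrals shows that every such limit
  for an indicator of a set of finite measure is, up to a null set, the random measure of that set
  (\<open>has_gaussian_integral_indicator_unique\<close>). It rests on the covariance formula
  \<open>E (W A * W B) = m (A \<inter> B)\<close>.
\<close>

section \<open>Moments of normal laws\<close>

lemma normal_law_moments:
  assumes "prob_space M" and [measurable]: "X \<in> borel_measurable M"
    and X: "distr M borel X = normal_law 0 v" and "0 \<le> v"
  shows normal_law_integrable_square: "integrable M (\<lambda>\<omega>. (X \<omega>)\<^sup>2)"
    and normal_law_integral_square: "(\<integral>\<omega>. (X \<omega>)\<^sup>2 \<partial>M) = v"
    and normal_law_integral_cos: "(\<integral>\<omega>. cos (X \<omega>) \<partial>M) = exp (- v / 2)"
proof -
  interpret prob_space M by fact
  have "integrable M (\<lambda>\<omega>. (X \<omega>)\<^sup>2) \<and> (\<integral>\<omega>. (X \<omega>)\<^sup>2 \<partial>M) = v \<and> (\<integral>\<omega>. cos (X \<omega>) \<partial>M) = exp (- v / 2)"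
  proof (cases "v = 0")
    case True
    have "distr M borel X = return borel 0"
      using X True by (simp add: normal_law_def)
    moreover have "AE x in return borel (0::real). x = 0"
      by (subst AE_return) auto
    ultimately have "AE x in distr M borel X. x = 0" by (rule ssubst)
    then have 0: "AE \<omega> in M. X \<omega> = 0"
      by (simp add: AE_distr_iff)
    have "integrable M (\<lambda>\<omega>. (X \<omega>)\<^sup>2) \<longleftrightarrow> integrable M (\<lambda>\<omega>. 0::real)"
      using 0 by (intro integrable_cong_AE) auto
    moreover have "(\<integral>\<omega>. (X \<omega>)\<^sup>2 \<partial>M) = (\<integral>\<omega>. 0 \<partial>M)"
      using 0 by (intro integral_cong_AE) auto
    moreover have "(\<integral>\<omega>. cos (X \<omega>) \<partial>M) = (\<integral>\<omega>. 1 \<partial>M)"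
      using 0 by (intro integral_cong_AE) auto
    ultimately show ?thesis by (simp add: True prob_space)
  next
    case False
    with \<open>0 \<le> v\<close> have v: "0 < v" by simp
    have X': "distr M borel X = density lborel (normal_density 0 (sqrt v))"
      using X False by (simp add: normal_law_def)
    have "distributed M lborel X (normal_density 0 (sqrt v))"
      unfolding distributed_def using X' by (simp cong: distr_cong)
    then have "distributed M lborel (\<lambda>\<omega>. (X \<omega> - 0) / sqrt v) std_normal_density"
      using v by (subst (asm) normal_standard_normal_convert) auto
    then have U: "distr M borel (\<lambda>\<omega>. X \<omega> / sqrt v) = std_normal_distribution"
      by (simp add: distributed_def cong: distr_cong)
    have "integrable (distr M borel (\<lambda>\<omega>. X \<omega> / sqrt v)) (\<lambda>x. x\<^sup>2)"
      unfolding U by (rule integrable_std_normal_distribution_moment)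
    then have "integrable M (\<lambda>\<omega>. (X \<omega> / sqrt v)\<^sup>2)"
      by (simp add: integrable_distr_eq)
    then have "integrable M (\<lambda>\<omega>. v * (X \<omega> / sqrt v)\<^sup>2)"
      by (rule integrable_mult_right)
    moreover have eq: "v * (X \<omega> / sqrt v)\<^sup>2 = (X \<omega>)\<^sup>2" for \<omega>
      using v by (simp add: power_divide)
    ultimately have 1: "integrable M (\<lambda>\<omega>. (X \<omega>)\<^sup>2)" by simp
    have "(\<integral>\<omega>. (X \<omega> / sqrt v)\<^sup>2 \<partial>M) = (\<integral>x. x\<^sup>2 \<partial>std_normal_distribution)"
      unfolding U[symmetric] by (simp add: integral_distr)
    also have "\<dots> = 1"
      using std_normal_distribution_even_moments[of 1] by simp
    finally have "v * (\<integral>\<omega>. (X \<omega> / sqrt v)\<^sup>2 \<partial>M) = v" by simp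
    then have 2: "(\<integral>\<omega>. (X \<omega>)\<^sup>2 \<partial>M) = v"
      unfolding integral_mult_right_zero[symmetric] eq .
    have "exp (- v / 2) = Re (char std_normal_distribution (sqrt v))"
      using v by (simp add: char_std_normal_distribution)
    also have "\<dots> = Re (\<integral>\<omega>. iexp (sqrt v * (X \<omega> / sqrt v)) \<partial>M)"
      unfolding char_def U[symmetric] by (subst integral_distr) auto
    also have "\<dots> = (\<integral>\<omega>. Re (iexp (sqrt v * (X \<omega> / sqrt v))) \<partial>M)"
      by (intro integral_Re[symmetric] integrable_const_bound[where B=1]) auto
    also have "\<dots> = (\<integral>\<omega>. cos (X \<omega>) \<partial>M)"
      using v by (simp add: Re_exp)
    finally show ?thesis using 1 2 by simp
  qed
  then show "integrable M (\<lambda>\<omega>. (X \<omega>)\<^sup>2)" "(\<integral>\<omega>. (X \<omega>)\<^sup>2 \<partial>M) = v" "(\<integral>\<omega>. cos (X \<omega>) \<partial>M) = exp (- v / 2)"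
    by auto
qed

lemma integrable_mult_of_squares:
  fixes f g :: "'a \<Rightarrow> real"
  assumes [measurable]: "f \<in> borel_measurable M" "g \<in> borel_measurable M"
    and "integrable M (\<lambda>x. (f x)\<^sup>2)" "integrable M (\<lambda>x. (g x)\<^sup>2)"
  shows "integrable M (\<lambda>x. f x * g x)"
proof (rule Bochner_Integration.integrable_bound)
  show "integrable M (\<lambda>x. (f x)\<^sup>2 + (g x)\<^sup>2)" using assms by simp
  show "AE x in M. norm (f x * g x) \<le> norm ((f x)\<^sup>2 + (g x)\<^sup>2)"
  proof (intro AE_I2)
    fix x
    have "0 \<le> (\<bar>f x\<bar> - \<bar>g x\<bar>)\<^sup>2" by simp
    then have "2 * (\<bar>f x\<bar> * \<bar>g x\<bar>) \<le> (f x)\<^sup>2 + (g x)\<^sup>2"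
      by (simp add: power2_diff)
    moreover have "0 \<le> \<bar>f x\<bar> * \<bar>g x\<bar>" by simp
    ultimately show "norm (f x * g x) \<le> norm ((f x)\<^sup>2 + (g x)\<^sup>2)"
      by (simp only: real_norm_def abs_mult)
  qed
qed measurable

section \<open>Weakly correlated normal variables\<close>

text \<open>
  The second moment form of the weak law of large numbers: after division by \<open>n\<^sup>2\<close> the bound is
  \<open>1 / n + \<delta>\<close>, small when the variables are nearly orthogonal.
\<close>

lemma integral_square_sum_le:
  fixes G :: "nat \<Rightarrow> 'a \<Rightarrow> real"
  assumes int: "\<And>j k. j < n \<Longrightarrow> k < n \<Longrightarrow> integrable M (\<lambda>\<omega>. G j \<omega> * G k \<omega>)"
    and diag: "\<And>k. k < n \<Longrightarrow> (\<integral>\<omega>. G k \<omega> * G k \<omega> \<partial>M) \<le> 1"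
    and off: "\<And>j k. j < n \<Longrightarrow> k < n \<Longrightarrow> j \<noteq> k \<Longrightarrow> (\<integral>\<omega>. G j \<omega> * G k \<omega> \<partial>M) \<le> \<delta>"
    and "0 \<le> \<delta>"
  shows "integrable M (\<lambda>\<omega>. (\<Sum>k<n. G k \<omega>)\<^sup>2)"
    and "(\<integral>\<omega>. (\<Sum>k<n. G k \<omega>)\<^sup>2 \<partial>M) \<le> real n + (real n)\<^sup>2 * \<delta>"
proof -
  have eq: "(\<Sum>k<n. G k \<omega>)\<^sup>2 = (\<Sum>j<n. \<Sum>k<n. G j \<omega> * G k \<omega>)" for \<omega>
    by (simp add: power2_eq_square sum_product)
  show "integrable M (\<lambda>\<omega>. (\<Sum>k<n. G k \<omega>)\<^sup>2)"
    unfolding eq by (intro Bochner_Integration.integrable_sum int) auto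
  have "(\<integral>\<omega>. (\<Sum>k<n. G k \<omega>)\<^sup>2 \<partial>M) = (\<Sum>j<n. \<Sum>k<n. (\<integral>\<omega>. G j \<omega> * G k \<omega> \<partial>M))"
    unfolding eq by (subst Bochner_Integration.integral_sum)
      (auto intro!: Bochner_Integration.integrable_sum int sum.cong Bochner_Integration.integral_sum)
  also have "\<dots> \<le> (\<Sum>j<n. \<Sum>k<n. (if j = k then 1 else 0) + \<delta>)"
  proof (intro sum_mono)
    fix j k assume "j \<in> {..<n}" "k \<in> {..<n}"
    then show "(\<integral>\<omega>. G j \<omega> * G k \<omega> \<partial>M) \<le> (if j = k then 1 else 0) + \<delta>"
      using diag[of j] off[of j k] \<open>0 \<le> \<delta>\<close> by (cases "j = k") auto
  qed
  also have "\<dots> = real n + (real n)\<^sup>2 * \<delta>"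
    by (simp add: sum.distrib power2_eq_square algebra_simps)
  finally show "(\<integral>\<omega>. (\<Sum>k<n. G k \<omega>)\<^sup>2 \<partial>M) \<le> real n + (real n)\<^sup>2 * \<delta>" .
qed

lemma one_minus_cos_le_abs: "1 - cos x \<le> \<bar>x\<bar>" for x :: real
proof -
  have "1 - cos x = 2 * (sin (x / 2))\<^sup>2"
    using cos_double_sin[of "x / 2"] by simp
  also have "(sin (x / 2))\<^sup>2 \<le> \<bar>sin (x / 2)\<bar>"
    using mult_left_le[of "\<bar>sin (x/2)\<bar>" "\<bar>sin (x/2)\<bar>"] by (simp add: power2_eq_square)
  also have "\<bar>sin (x / 2)\<bar> \<le> \<bar>x / 2\<bar>" by (rule abs_sin_x_le_abs_x)
  finally show ?thesis by simp
qed

lemma exp_plus_exp_minus_le: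
  fixes x :: real assumes "0 \<le> x" "x \<le> 1"
  shows "(exp x + exp (- x)) / 2 \<le> 1 + x"
proof -
  have "exp x \<le> 1 + x + x\<^sup>2" using assms by (rule exp_bound)
  moreover have "x\<^sup>2 \<le> x" using assms by (simp add: power2_eq_square mult_left_le)
  moreover have "exp (- x) \<le> 1" using assms by simp
  ultimately have "exp x + exp (- x) \<le> 2 + 2 * x" by linarith
  then show ?thesis by simp
qed

text \<open>
  If all \<open>Z k \<le> \<epsilon>\<close>, then \<open>1 - cos (Z k) \<le> \<bar>Z k\<bar> \<le> 2 * \<epsilon> - Z k\<close>, so the averages of \<open>Z k\<close> and of
  \<open>cos (Z k) - exp (-1/2)\<close> cannot both be small when \<open>\<epsilon>\<close> is. But these variables have mean \<open>0\<close>, and weak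
  correlation makes both averages small in \<open>L\<^sup>2\<close>. The cosine is used because \<open>cos x * cos y\<close> is the mean of
  \<open>cos (x + y)\<close> and \<open>cos (x - y)\<close>: its expectation needs only the laws of sums and differences, and no joint
  density.
\<close>

lemma weakly_correlated_normal_all_le:
  fixes Z :: "nat \<Rightarrow> 'a \<Rightarrow> real" and n :: nat
  assumes "prob_space M" and Z[measurable]: "\<And>k. Z k \<in> borel_measurable M"
    and add: "\<And>j k. j < n \<Longrightarrow> k < n \<Longrightarrow>
      \<exists>v\<ge>0. distr M borel (\<lambda>\<omega>. Z j \<omega> + Z k \<omega>) = normal_law 0 v"
    and diff: "\<And>j k. j < n \<Longrightarrow> k < n \<Longrightarrow>
      \<exists>v\<ge>0. distr M borel (\<lambda>\<omega>. Z j \<omega> - Z k \<omega>) = normal_law 0 v"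
    and std: "\<And>k. k < n \<Longrightarrow> distr M borel (Z k) = normal_law 0 1"
    and cor: "\<And>j k. j < n \<Longrightarrow> k < n \<Longrightarrow> j \<noteq> k \<Longrightarrow>
      0 \<le> (\<integral>\<omega>. Z j \<omega> * Z k \<omega> \<partial>M) \<and> (\<integral>\<omega>. Z j \<omega> * Z k \<omega> \<partial>M) \<le> \<delta>"
    and \<delta>: "0 \<le> \<delta>" "\<delta> \<le> 1" and "0 < n"
    and \<epsilon>: "\<epsilon> \<le> (1 - exp (- 1 / 2)) / 4"
  shows "measure M {\<omega>\<in>space M. \<forall>k<n. Z k \<omega> \<le> \<epsilon>} \<le> 16 / (1 - exp (- 1 / 2))\<^sup>2 * (1 / n + \<delta>)"
proof -
  interpret prob_space M by fact
  define a where "a = exp (- 1 / 2 :: real)"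
  define c where "c = 1 - a"
  have a: "0 < a" "a < 1" by (auto simp: a_def)
  have c: "0 < c" using a by (simp add: c_def)
  define G where "G k \<omega> = cos (Z k \<omega>) - a" for k \<omega>
  have [measurable]: "G k \<in> borel_measurable M" for k unfolding G_def by measurable
  have sq: "integrable M (\<lambda>\<omega>. (Z k \<omega>)\<^sup>2)" "(\<integral>\<omega>. (Z k \<omega>)\<^sup>2 \<partial>M) = 1" "(\<integral>\<omega>. cos (Z k \<omega>) \<partial>M) = a"
    if "k < n" for k
    using normal_law_moments[OF assms(1) Z std[OF that]] by (auto simp: a_def)
  have int: "integrable M (\<lambda>\<omega>. Z j \<omega> * Z k \<omega>)" if "j < n" "k < n" for j k
    using that by (intro integrable_mult_of_squares sq) auto
  have A: "integrable M (\<lambda>\<omega>. (\<Sum>k<n. Z k \<omega>)\<^sup>2)" "(\<integral>\<omega>. (\<Sum>k<n. Z k \<omega>)\<^sup>2 \<partial>M) \<le> real n + (real n)\<^sup>2 * \<delta>"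
    using int cor sq(2) \<delta>
    by (intro integral_square_sum_le[of n M Z \<delta>]; simp add: power2_eq_square)+
  have bnd: "integrable M f" if "\<And>\<omega>. \<bar>f \<omega>\<bar> \<le> B" "f \<in> borel_measurable M" for f and B :: real
    using that by (intro integrable_const_bound[where B=B]) auto
  have cosint: "integrable M (\<lambda>\<omega>. cos (f \<omega>))" if "f \<in> borel_measurable M" for f :: "'a \<Rightarrow> real"
    using that by (intro bnd[of _ 1]) auto
  have coscos: "integrable M (\<lambda>\<omega>. cos (Z j \<omega>) * cos (Z k \<omega>))" for j k
    by (intro bnd[of _ 1]) (auto simp: abs_mult intro!: mult_le_one)
  have GG: "integrable M (\<lambda>\<omega>. G j \<omega> * G k \<omega>)" for j k
    using coscos[of j k] cosint[OF Z[of j]] cosint[OF Z[of k]]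
    by (simp add: G_def algebra_simps)
  have GGint: "(\<integral>\<omega>. G j \<omega> * G k \<omega> \<partial>M) = (\<integral>\<omega>. cos (Z j \<omega>) * cos (Z k \<omega>) \<partial>M) - a\<^sup>2" if "j < n" "k < n" for j k
  proof -
    have "(\<integral>\<omega>. G j \<omega> * G k \<omega> \<partial>M) =
      (\<integral>\<omega>. cos (Z j \<omega>) * cos (Z k \<omega>) - a * cos (Z j \<omega>) - a * cos (Z k \<omega>) + a\<^sup>2 \<partial>M)"
      by (simp add: G_def algebra_simps power2_eq_square)
    also have "\<dots> = (\<integral>\<omega>. cos (Z j \<omega>) * cos (Z k \<omega>) \<partial>M) - a * a - a * a + a\<^sup>2"
      using coscos[of j k] cosint[OF Z[of j]] cosint[OF Z[of k]] that by (simp add: sq prob_space)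
    finally show ?thesis by (simp add: power2_eq_square)
  qed
  have diag: "(\<integral>\<omega>. G k \<omega> * G k \<omega> \<partial>M) \<le> 1" if "k < n" for k
  proof -
    have "(\<integral>\<omega>. cos (Z k \<omega>) * cos (Z k \<omega>) \<partial>M) \<le> (\<integral>\<omega>. 1 \<partial>M)"
    proof (rule integral_mono[OF coscos])
      show "cos (Z k \<omega>) * cos (Z k \<omega>) \<le> 1" for \<omega>
        using abs_cos_le_one[of "Z k \<omega>"] abs_square_le_1[of "cos (Z k \<omega>)"]
        by (simp only: power2_eq_square)
    qed simp
    then have "(\<integral>\<omega>. cos (Z k \<omega>) * cos (Z k \<omega>) \<partial>M) \<le> 1"
      by (simp add: prob_space)
    moreover have "0 \<le> a\<^sup>2" by simp
    ultimately show ?thesis using GGint[OF that that] by linarith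
  qed
  have off: "(\<integral>\<omega>. G j \<omega> * G k \<omega> \<partial>M) \<le> \<delta>" if jk: "j < n" "k < n" "j \<noteq> k" for j k
  proof -
    define \<rho> where "\<rho> = (\<integral>\<omega>. Z j \<omega> * Z k \<omega> \<partial>M)"
    have \<rho>: "0 \<le> \<rho>" "\<rho> \<le> \<delta>" using cor[OF jk] by (auto simp: \<rho>_def)
    obtain u where u: "0 \<le> u" "distr M borel (\<lambda>\<omega>. Z j \<omega> + Z k \<omega>) = normal_law 0 u"
      using add jk by blast
    obtain v where v: "0 \<le> v" "distr M borel (\<lambda>\<omega>. Z j \<omega> - Z k \<omega>) = normal_law 0 v"
      using diff jk by blast
    have "u = (\<integral>\<omega>. (Z j \<omega> + Z k \<omega>)\<^sup>2 \<partial>M)"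
      using normal_law_integral_square[OF assms(1) _ u(2,1)] by simp
    also have "\<dots> = (\<integral>\<omega>. (Z j \<omega>)\<^sup>2 + (Z k \<omega>)\<^sup>2 + 2 * (Z j \<omega> * Z k \<omega>) \<partial>M)"
      by (simp add: power2_sum mult.assoc)
    also have "\<dots> = 2 + 2 * \<rho>"
      using jk sq int[of j k] by (simp add: \<rho>_def)
    finally have u': "u = 2 + 2 * \<rho>" .
    have "v = (\<integral>\<omega>. (Z j \<omega> - Z k \<omega>)\<^sup>2 \<partial>M)"
      using normal_law_integral_square[OF assms(1) _ v(2,1)] by simp
    also have "\<dots> = (\<integral>\<omega>. (Z j \<omega>)\<^sup>2 + (Z k \<omega>)\<^sup>2 - 2 * (Z j \<omega> * Z k \<omega>) \<partial>M)"
      by (simp add: power2_diff mult.assoc)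
    also have "\<dots> = 2 - 2 * \<rho>"
      using jk sq int[of j k] by (simp add: \<rho>_def)
    finally have v': "v = 2 - 2 * \<rho>" .
    have "(\<integral>\<omega>. cos (Z j \<omega>) * cos (Z k \<omega>) \<partial>M) =
      (\<integral>\<omega>. (cos (Z j \<omega> - Z k \<omega>) + cos (Z j \<omega> + Z k \<omega>)) / 2 \<partial>M)"
      by (simp add: cos_times_cos)
    also have "\<dots> = ((\<integral>\<omega>. cos (Z j \<omega> - Z k \<omega>) \<partial>M) + (\<integral>\<omega>. cos (Z j \<omega> + Z k \<omega>) \<partial>M)) / 2"
      by (subst integral_divide_zero, subst Bochner_Integration.integral_add) (auto intro!: cosint)
    also have "\<dots> = (exp (- v / 2) + exp (- u / 2)) / 2"
      using normal_law_integral_cos[OF assms(1) _ u(2,1)] normal_law_integral_cos[OF assms(1) _ v(2,1)] by simp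
    \<comment> \<open>This is \<open>exp (-1) * cosh \<rho>\<close>, which exceeds the uncorrelated value \<open>a\<^sup>2\<close> by at most \<open>\<rho>\<close>.\<close>
    also have "\<dots> = a\<^sup>2 * ((exp \<rho> + exp (- \<rho>)) / 2)"
    proof -
      have "a\<^sup>2 = exp (- 1)" by (simp add: a_def flip: exp_double)
      moreover have "- v / 2 = - 1 + \<rho>" "- u / 2 = - 1 + (- \<rho>)" by (simp_all add: u' v')
      ultimately show ?thesis by (simp only: exp_add) (simp add: algebra_simps)
    qed
    also have "\<dots> \<le> a\<^sup>2 * (1 + \<rho>)"
      using \<rho> \<delta> by (intro mult_left_mono exp_plus_exp_minus_le) auto
    also have "\<dots> \<le> a\<^sup>2 + \<rho>"
      using a \<rho> by (simp add: distrib_left power_le_one mult_left_le_one_le)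
    finally show ?thesis using GGint[OF jk(1,2)] \<rho> by simp
  qed
  have C: "integrable M (\<lambda>\<omega>. (\<Sum>k<n. G k \<omega>)\<^sup>2)" "(\<integral>\<omega>. (\<Sum>k<n. G k \<omega>)\<^sup>2 \<partial>M) \<le> real n + (real n)\<^sup>2 * \<delta>"
    using GG diag off \<delta> by (intro integral_square_sum_le[of n M G \<delta>]; simp)+
  define B where "B = {\<omega>\<in>space M. \<forall>k<n. Z k \<omega> \<le> \<epsilon>}"
  have [measurable]: "B \<in> sets M" unfolding B_def by measurable
  \<comment> \<open>On \<open>B\<close> every \<open>G k - Z k\<close> is at least \<open>c / 2\<close>, which turns \<open>B\<close> into a large deviation of two sums.\<close>
  have pt: "(n * (c / 2))\<^sup>2 * indicator B \<omega> \<le> 2 * (\<Sum>k<n. Z k \<omega>)\<^sup>2 + 2 * (\<Sum>k<n. G k \<omega>)\<^sup>2" for \<omega>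
  proof (cases "\<omega> \<in> B")
    case True
    have "c / 2 \<le> G k \<omega> - Z k \<omega>" if "k < n" for k :: nat
    proof -
      have "Z k \<omega> \<le> c / 4" using True that \<epsilon> by (force simp: B_def c_def a_def)
      moreover have "c - G k \<omega> = 1 - cos (Z k \<omega>)" by (simp add: c_def G_def)
      ultimately show ?thesis using one_minus_cos_le_abs[of "Z k \<omega>"] c by linarith
    qed
    then have "(\<Sum>k<n. c / 2) \<le> (\<Sum>k<n. G k \<omega> - Z k \<omega>)"
      by (intro sum_mono) simp
    then have "n * (c / 2) \<le> (\<Sum>k<n. G k \<omega>) - (\<Sum>k<n. Z k \<omega>)"
      by (simp add: sum_subtractf)
    then have "(n * (c / 2))\<^sup>2 \<le> ((\<Sum>k<n. G k \<omega>) - (\<Sum>k<n. Z k \<omega>))\<^sup>2"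
      using c by (intro power_mono) auto
    also have "\<dots> \<le> 2 * (\<Sum>k<n. Z k \<omega>)\<^sup>2 + 2 * (\<Sum>k<n. G k \<omega>)\<^sup>2"
      using zero_le_power2[of "(\<Sum>k<n. G k \<omega>) + (\<Sum>k<n. Z k \<omega>)"]
      by (simp add: power2_sum power2_diff)
    finally show ?thesis using True by simp
  qed simp
  have "(n * (c / 2))\<^sup>2 * measure M B = (\<integral>\<omega>. (n * (c / 2))\<^sup>2 * indicator B \<omega> \<partial>M)"
    by simp
  also have "\<dots> \<le> (\<integral>\<omega>. 2 * (\<Sum>k<n. Z k \<omega>)\<^sup>2 + 2 * (\<Sum>k<n. G k \<omega>)\<^sup>2 \<partial>M)"
    using pt A(1) C(1)
    by (intro integral_mono integrable_mult_right integrable_real_indicator) (auto simp: less_top[symmetric])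
  also have "\<dots> \<le> 4 * (real n + (real n)\<^sup>2 * \<delta>)"
    using A C by simp
  finally have "c\<^sup>2 * (real n)\<^sup>2 / 4 * measure M B \<le> 4 * (real n + (real n)\<^sup>2 * \<delta>)"
    by (simp add: power_mult_distrib power_divide mult_ac)
  also have "4 * (real n + (real n)\<^sup>2 * \<delta>) = c\<^sup>2 * (real n)\<^sup>2 / 4 * (16 / c\<^sup>2 * (1 / n + \<delta>))"
    using c \<open>0 < n\<close> by (simp add: field_simps power2_eq_square)
  finally have "measure M B \<le> 16 / c\<^sup>2 * (1 / n + \<delta>)"
    by (rule mult_left_le_imp_le) (use c \<open>0 < n\<close> in simp)
  then show ?thesis unfolding B_def c_def a_def .
qed

section \<open>The integral with respect to a Gaussian random measure\<close>

lemma gaussian_random_measureD: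
  assumes "gaussian_random_measure P m W" and "A \<in> sets m" and "emeasure m A < \<infinity>"
  shows gaussian_random_measure_borel: "W A \<in> borel_measurable P"
    and gaussian_random_measure_law: "distr P borel (W A) = normal_law 0 (measure m A)"
  using assms unfolding gaussian_random_measure_def by auto

lemma gaussian_random_measure_indep:
  fixes n :: nat
  assumes "gaussian_random_measure P m W"
    and "\<And>i. i < n \<Longrightarrow> A i \<in> sets m" and "\<And>i. i < n \<Longrightarrow> emeasure m (A i) < \<infinity>"
    and "disjoint_family_on A {..<n}"
  shows "prob_space.indep_vars P (\<lambda>_. borel) (\<lambda>i. W (A i)) {..<n}"
  using assms unfolding gaussian_random_measure_def by blast

lemma gaussian_random_measure_null:
  assumes "gaussian_random_measure P m W" and "A \<in> sets m" and "emeasure m A = 0"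
  shows "AE \<omega> in P. W A \<omega> = 0"
proof -
  have [measurable]: "W A \<in> borel_measurable P"
    using assms by (intro gaussian_random_measure_borel) auto
  have "distr P borel (W A) = return borel 0"
    using gaussian_random_measure_law[of P m W A] assms by (simp add: normal_law_def measure_def)
  moreover have "AE x in return borel (0::real). x = 0"
    by (subst AE_return) auto
  ultimately have "AE x in distr P borel (W A). x = 0" by (rule ssubst)
  then show ?thesis by (simp add: AE_distr_iff)
qed

lemma gaussian_random_measure_Un:
  assumes W: "gaussian_random_measure P m W"
    and A: "A \<in> sets m" "emeasure m A < \<infinity>" and B: "B \<in> sets m" "emeasure m B < \<infinity>"
    and "A \<inter> B = {}"
  shows "AE \<omega> in P. W (A \<union> B) \<omega> = W A \<omega> + W B \<omega>"
proof -
  define F where "F i = (if i = 0 then A else if i = 1 then B else {})" for i :: nat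
  have U: "(\<Union>i. F i) = A \<union> B"
    by (force simp: F_def split: if_splits)
  have "emeasure m (A \<union> B) \<le> emeasure m A + emeasure m B"
    using A B by (intro emeasure_subadditive) auto
  also have "\<dots> < \<infinity>" using A B by simp
  finally have "emeasure m (\<Union>i. F i) < \<infinity>" unfolding U .
  moreover have "range F \<subseteq> sets m" "disjoint_family F"
    using A B \<open>A \<inter> B = {}\<close> by (auto simp: F_def disjoint_family_on_def)
  ultimately have "AE \<omega> in P. (\<lambda>i. W (F i) \<omega>) sums W (\<Union>i. F i) \<omega>"
    using W unfolding gaussian_random_measure_def by blast
  moreover have "AE \<omega> in P. W {} \<omega> = 0"
    using W by (rule gaussian_random_measure_null) auto
  ultimately show ?thesis
  proof eventually_elim
    case (elim \<omega>)
    have "(\<lambda>i. W (F i) \<omega>) sums (\<Sum>i<2. W (F i) \<omega>)"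
      using elim(2) by (intro sums_finite) (auto simp: F_def)
    with elim(1) have "W (\<Union>i. F i) \<omega> = (\<Sum>i<2. W (F i) \<omega>)" by (rule sums_unique2)
    then show ?case unfolding U by (simp add: F_def lessThan_nat_numeral)
  qed
qed

text \<open>
  Disjoint sets have uncorrelated masses: by additivity, the variance of \<open>W (C \<union> D)\<close> is the sum of the
  variances plus twice the covariance, and it equals \<open>m C + m D\<close>. Splitting \<open>A\<close> and \<open>B\<close> along
  \<open>A \<inter> B\<close> leaves only the variance of the common part.
\<close>

lemma gaussian_random_measure_covariance:
  assumes "prob_space P" and W: "gaussian_random_measure P m W"
    and A: "A \<in> sets m" "emeasure m A < \<infinity>" and B: "B \<in> sets m" "emeasure m B < \<infinity>"
  shows gaussian_random_measure_integrable_mult: "integrable P (\<lambda>\<omega>. W A \<omega> * W B \<omega>)"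
    and gaussian_random_measure_integral_mult: "(\<integral>\<omega>. W A \<omega> * W B \<omega> \<partial>P) = measure m (A \<inter> B)"
proof -
  let ?fin = "\<lambda>A. A \<in> sets m \<and> emeasure m A < \<infinity>"
  have bor: "W C \<in> borel_measurable P" if "?fin C" for C
    using that W by (auto intro: gaussian_random_measure_borel)
  have sq: "integrable P (\<lambda>\<omega>. (W C \<omega>)\<^sup>2)" "(\<integral>\<omega>. (W C \<omega>)\<^sup>2 \<partial>P) = measure m C" if "?fin C" for C
    using normal_law_moments[OF assms(1) bor[OF that] gaussian_random_measure_law[OF W]] that by auto
  have int: "integrable P (\<lambda>\<omega>. W C \<omega> * W D \<omega>)" if "?fin C" "?fin D" for C D
    using that by (intro integrable_mult_of_squares bor sq)
  show "integrable P (\<lambda>\<omega>. W A \<omega> * W B \<omega>)" using A B by (intro int) auto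
  have sub: "?fin C" if "?fin D" "C \<subseteq> D" "C \<in> sets m" for C D
    using that by (metis emeasure_mono order_le_less_trans)
  have orth: "(\<integral>\<omega>. W C \<omega> * W D \<omega> \<partial>P) = 0" if CD: "?fin C" "?fin D" and dis: "C \<inter> D = {}" for C D
  proof -
    have fin: "?fin (C \<union> D)"
      using CD emeasure_subadditive[of C m D] by (auto simp: order_le_less_trans)
    have "(\<integral>\<omega>. (W (C \<union> D) \<omega>)\<^sup>2 \<partial>P) = (\<integral>\<omega>. (W C \<omega> + W D \<omega>)\<^sup>2 \<partial>P)"
      using gaussian_random_measure_Un[OF W _ _ _ _ dis] CD bor[OF fin] bor[OF CD(1)] bor[OF CD(2)]
      by (intro integral_cong_AE) auto
    also have "\<dots> = (\<integral>\<omega>. (W C \<omega>)\<^sup>2 + (W D \<omega>)\<^sup>2 + 2 * (W C \<omega> * W D \<omega>) \<partial>P)"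
      by (simp add: power2_sum mult.assoc)
    also have "\<dots> = measure m C + measure m D + 2 * (\<integral>\<omega>. W C \<omega> * W D \<omega> \<partial>P)"
      using sq[OF CD(1)] sq[OF CD(2)] int[OF CD] by simp
    finally show ?thesis
      using sq[OF fin] CD measure_Un2[of C m D] dis
      by (simp add: fmeasurable_def Diff_triv Int_commute)
  qed
  let ?I = "A \<inter> B" and ?A = "A - B" and ?B = "B - A"
  have fin: "?fin ?I" "?fin ?A" "?fin ?B"
    using A B sub[of A ?I] sub[of A ?A] sub[of B ?B] by blast+
  have "AE \<omega> in P. W (?I \<union> ?A) \<omega> = W ?I \<omega> + W ?A \<omega>" "AE \<omega> in P. W (?I \<union> ?B) \<omega> = W ?I \<omega> + W ?B \<omega>"
    using fin by (auto intro!: gaussian_random_measure_Un[OF W])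
  moreover have "?I \<union> ?A = A" "?I \<union> ?B = B" by auto
  ultimately have "AE \<omega> in P. W A \<omega> = W ?I \<omega> + W ?A \<omega>" "AE \<omega> in P. W B \<omega> = W ?I \<omega> + W ?B \<omega>"
    by auto
  then have "(\<integral>\<omega>. W A \<omega> * W B \<omega> \<partial>P) = (\<integral>\<omega>. (W ?I \<omega> + W ?A \<omega>) * (W ?I \<omega> + W ?B \<omega>) \<partial>P)"
    using A B bor[OF fin(1)] bor[OF fin(2)] bor[OF fin(3)] bor[of A] bor[of B]
    by (intro integral_cong_AE) auto
  also have "\<dots> = (\<integral>\<omega>. (W ?I \<omega>)\<^sup>2 + W ?I \<omega> * W ?B \<omega> + W ?A \<omega> * W ?I \<omega> + W ?A \<omega> * W ?B \<omega> \<partial>P)"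
    by (simp add: algebra_simps power2_eq_square)
  also have "\<dots> = measure m ?I + 0 + 0 + 0"
  proof -
    have "?I \<inter> ?B = {}" "?A \<inter> ?I = {}" "?A \<inter> ?B = {}" by auto
    then have "(\<integral>\<omega>. W ?I \<omega> * W ?B \<omega> \<partial>P) = 0" "(\<integral>\<omega>. W ?A \<omega> * W ?I \<omega> \<partial>P) = 0"
      "(\<integral>\<omega>. W ?A \<omega> * W ?B \<omega> \<partial>P) = 0"
      using fin by (auto intro!: orth)
    then show ?thesis
      using sq[OF fin(1)] int[OF fin(1,3)] int[OF fin(2,1)] int[OF fin(2,3)] by simp
  qed
  finally show "(\<integral>\<omega>. W A \<omega> * W B \<omega> \<partial>P) = measure m (A \<inter> B)" by simp
qed

text \<open>
  Expanding both squares gives the same double sum of \<open>c i * c j * m (A i \<inter> A j)\<close>. The sets may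
  overlap, which spares a refinement into a common partition.
\<close>

lemma gaussian_random_measure_isometry:
  assumes "prob_space P" and W: "gaussian_random_measure P m W" and "finite I"
    and A: "\<And>i. i \<in> I \<Longrightarrow> A i \<in> sets m" "\<And>i. i \<in> I \<Longrightarrow> emeasure m (A i) < \<infinity>"
  shows "(\<integral>\<^sup>+\<omega>. ennreal ((\<Sum>i\<in>I. c i * W (A i) \<omega>)\<^sup>2) \<partial>P) =
    (\<integral>\<^sup>+z. ennreal ((\<Sum>i\<in>I. c i * indicator (A i) z)\<^sup>2) \<partial>m)"
proof -
  have cov: "integrable P (\<lambda>\<omega>. W (A i) \<omega> * W (A j) \<omega>)"
    "(\<integral>\<omega>. W (A i) \<omega> * W (A j) \<omega> \<partial>P) = measure m (A i \<inter> A j)" if "i \<in> I" "j \<in> I" for i j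
    using gaussian_random_measure_covariance[OF assms(1) W] A that by auto
  have ind: "integrable m (\<lambda>z. indicator (A i) z * indicator (A j) z :: real)"
    "(\<integral>z. indicator (A i) z * indicator (A j) z \<partial>m) = measure m (A i \<inter> A j)" if "i \<in> I" "j \<in> I" for i j
  proof -
    have "emeasure m (A i \<inter> A j) < \<infinity>"
      using A that by (metis emeasure_mono inf_le1 order_le_less_trans)
    moreover have "A i \<inter> A j \<in> sets m" using A that by auto
    moreover have "A i \<inter> A j \<inter> space m = A i \<inter> A j"
      using sets.sets_into_space[OF A(1)[OF that(1)]] by auto
    ultimately show "integrable m (\<lambda>z. indicator (A i) z * indicator (A j) z :: real)"
      "(\<integral>z. indicator (A i) z * indicator (A j) z \<partial>m) = measure m (A i \<inter> A j)"
      by (simp_all flip: indicator_inter_arith)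
  qed
  have sq: "(\<Sum>i\<in>I. c i * g i)\<^sup>2 = (\<Sum>i\<in>I. \<Sum>j\<in>I. c i * c j * (g i * g j))" for g :: "_ \<Rightarrow> real"
    by (simp add: power2_eq_square sum_product mult_ac)
  have intW: "integrable P (\<lambda>\<omega>. (\<Sum>i\<in>I. c i * W (A i) \<omega>)\<^sup>2)"
    unfolding sq by (intro Bochner_Integration.integrable_sum integrable_mult_right cov)
  have intA: "integrable m (\<lambda>z. (\<Sum>i\<in>I. c i * indicator (A i) z)\<^sup>2)"
    unfolding sq by (intro Bochner_Integration.integrable_sum integrable_mult_right ind)
  have "(\<integral>\<^sup>+\<omega>. ennreal ((\<Sum>i\<in>I. c i * W (A i) \<omega>)\<^sup>2) \<partial>P) = ennreal (\<integral>\<omega>. (\<Sum>i\<in>I. c i * W (A i) \<omega>)\<^sup>2 \<partial>P)"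
    using intW by (intro nn_integral_eq_integral) auto
  also have "(\<integral>\<omega>. (\<Sum>i\<in>I. c i * W (A i) \<omega>)\<^sup>2 \<partial>P) = (\<Sum>i\<in>I. \<Sum>j\<in>I. c i * c j * measure m (A i \<inter> A j))"
    unfolding sq using cov by (simp add: Bochner_Integration.integral_sum Bochner_Integration.integrable_sum)
  also have "\<dots> = (\<integral>z. (\<Sum>i\<in>I. c i * indicator (A i) z)\<^sup>2 \<partial>m)"
    unfolding sq using ind by (simp add: Bochner_Integration.integral_sum Bochner_Integration.integrable_sum)
  also have "ennreal \<dots> = (\<integral>\<^sup>+z. ennreal ((\<Sum>i\<in>I. c i * indicator (A i) z)\<^sup>2) \<partial>m)"
    using intA by (intro nn_integral_eq_integral[symmetric]) auto
  finally show ?thesis .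
qed

lemma simple_bochner_integrable_level_set:
  assumes "Bochner_Integration.simple_bochner_integrable m s" and "y \<noteq> 0"
  shows "{z\<in>space m. s z = y} \<in> sets m" and "emeasure m {z\<in>space m. s z = y} < \<infinity>"
proof -
  have sf: "simple_function m s" and fin: "emeasure m {z\<in>space m. s z \<noteq> 0} \<noteq> \<infinity>"
    using assms by (auto elim: simple_bochner_integrable.cases)
  have [measurable]: "s \<in> measurable m (count_space UNIV)"
    using sf by (rule measurable_simple_function)
  show "{z\<in>space m. s z = y} \<in> sets m" by measurable
  have "emeasure m {z\<in>space m. s z = y} \<le> emeasure m {z\<in>space m. s z \<noteq> 0}"
    using \<open>y \<noteq> 0\<close> by (intro emeasure_mono) auto
  also have "\<dots> < \<infinity>" using fin by (simp add: less_top)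
  finally show "emeasure m {z\<in>space m. s z = y} < \<infinity>" .
qed

text \<open>
  The level set \<open>s = 0\<close> contributes nothing, and may have infinite measure. Its index is reused for the
  set \<open>A\<close> with coefficient \<open>-1\<close>, so that the difference is one finite combination of masses.
\<close>

lemma simple_gaussian_integral_isometry:
  assumes "prob_space P" and W: "gaussian_random_measure P m W"
    and s: "Bochner_Integration.simple_bochner_integrable m s"
    and A: "A \<in> sets m" "emeasure m A < \<infinity>"
  shows "(\<integral>\<^sup>+\<omega>. ennreal ((simple_gaussian_integral m W s \<omega> - W A \<omega>)\<^sup>2) \<partial>P) =
    (\<integral>\<^sup>+z. ennreal ((s z - indicator A z)\<^sup>2) \<partial>m)"
proof -
  have sf: "simple_function m s"
    using s by (auto elim: simple_bochner_integrable.cases)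
  define I where "I = insert 0 (s ` space m)"
  define c where "c y = (if y = 0 then - 1 else y)" for y :: real
  define D where "D y = (if y = 0 then A else {z\<in>space m. s z = y})" for y
  have "finite I" using sf by (simp add: I_def simple_function_def)
  have D: "D y \<in> sets m" "emeasure m (D y) < \<infinity>" for y
    using A simple_bochner_integrable_level_set[OF s, of y] by (auto simp: D_def)
  have split: "(\<Sum>y\<in>I. c y * g (D y)) = (\<Sum>y\<in>s ` space m. y * g {z\<in>space m. s z = y}) - g A"
    for g :: "_ \<Rightarrow> real"
  proof -
    have "(\<Sum>y\<in>I. c y * g (D y)) = c 0 * g (D 0) + (\<Sum>y\<in>I - {0}. c y * g (D y))"
      using \<open>finite I\<close> by (subst sum.remove[of I 0]) (auto simp: I_def)
    also have "(\<Sum>y\<in>I - {0}. c y * g (D y)) = (\<Sum>y\<in>I - {0}. y * g {z\<in>space m. s z = y})"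
      by (intro sum.cong) (auto simp: c_def D_def)
    also have "\<dots> = (\<Sum>y\<in>s ` space m. y * g {z\<in>space m. s z = y})"
      using \<open>finite I\<close> by (intro sum.mono_neutral_cong) (auto simp: I_def)
    finally show ?thesis by (simp add: c_def D_def)
  qed
  have "(\<integral>\<^sup>+\<omega>. ennreal ((simple_gaussian_integral m W s \<omega> - W A \<omega>)\<^sup>2) \<partial>P)
      = (\<integral>\<^sup>+\<omega>. ennreal ((\<Sum>y\<in>I. c y * W (D y) \<omega>)\<^sup>2) \<partial>P)"
    using split[of "\<lambda>B. W B _"] by (simp add: simple_gaussian_integral_def)
  also have "\<dots> = (\<integral>\<^sup>+z. ennreal ((\<Sum>y\<in>I. c y * indicator (D y) z)\<^sup>2) \<partial>m)"
    using D by (intro gaussian_random_measure_isometry[OF assms(1) W \<open>finite I\<close>])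
  also have "\<dots> = (\<integral>\<^sup>+z. ennreal ((s z - indicator A z)\<^sup>2) \<partial>m)"
  proof (intro nn_integral_cong)
    fix z assume z: "z \<in> space m"
    have "(\<Sum>y\<in>s ` space m. y * indicator {z\<in>space m. s z = y} z) = (\<Sum>y\<in>{s z}. y)"
      using sf z by (intro sum.mono_neutral_cong_right) (auto simp: simple_function_def)
    then show "ennreal ((\<Sum>y\<in>I. c y * indicator (D y) z)\<^sup>2) = ennreal ((s z - indicator A z)\<^sup>2)"
      using split[of "\<lambda>B. indicator B z"] by simp
  qed
  finally show ?thesis .
qed

lemma nn_integral_square_add_le:
  fixes f g :: "'a \<Rightarrow> real"
  assumes [measurable]: "f \<in> borel_measurable M" "g \<in> borel_measurable M"
  shows "(\<integral>\<^sup>+x. ennreal ((f x + g x)\<^sup>2) \<partial>M) \<le>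
    2 * (\<integral>\<^sup>+x. ennreal ((f x)\<^sup>2) \<partial>M) + 2 * (\<integral>\<^sup>+x. ennreal ((g x)\<^sup>2) \<partial>M)"
proof -
  have "(f x + g x)\<^sup>2 \<le> 2 * (f x)\<^sup>2 + 2 * (g x)\<^sup>2" for x
    using zero_le_power2[of "f x - g x"] by (simp add: power2_sum power2_diff)
  then have "(\<integral>\<^sup>+x. ennreal ((f x + g x)\<^sup>2) \<partial>M) \<le> (\<integral>\<^sup>+x. 2 * ennreal ((f x)\<^sup>2) + 2 * ennreal ((g x)\<^sup>2) \<partial>M)"
    by (intro nn_integral_mono) (simp add: ennreal_leI flip: ennreal_numeral ennreal_mult' ennreal_plus)
  then show ?thesis by (simp add: nn_integral_add nn_integral_cmult)
qed

text \<open>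
  The constant sequence \<open>indicator A\<close> approximates \<open>f\<close>.
\<close>

lemma has_gaussian_integral_indicator:
  assumes "prob_space P" and W: "gaussian_random_measure P m W"
    and A: "A \<in> sets m" "emeasure m A < \<infinity>"
    and f: "f \<in> borel_measurable m" "AE z in m. f z = indicator A z"
  shows "has_gaussian_integral P m W f (W A)"
proof -
  have "{z\<in>space m. indicator A z \<noteq> (0::real)} = A"
    using sets.sets_into_space[OF A(1)] by (auto simp: indicator_def)
  then have s: "Bochner_Integration.simple_bochner_integrable m (indicator A :: _ \<Rightarrow> real)"
    using A by (intro simple_bochner_integrable.intros simple_function_indicator) (auto simp del: indicator_eq_0_iff)
  have "(\<integral>\<^sup>+z. ennreal ((indicator A z - f z)\<^sup>2) \<partial>m) = (\<integral>\<^sup>+z. 0 \<partial>m)"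
    using f(2) by (intro nn_integral_cong_AE) auto
  moreover have "(\<integral>\<^sup>+\<omega>. ennreal ((simple_gaussian_integral m W (indicator A) \<omega> - W A \<omega>)\<^sup>2) \<partial>P) = 0"
    by (subst simple_gaussian_integral_isometry[OF assms(1) W s A]) simp
  moreover have "W A \<in> borel_measurable P"
    using W A by (rule gaussian_random_measure_borel)
  ultimately show ?thesis
    unfolding has_gaussian_integral_def using f(1) s
    by (intro conjI exI[of _ "\<lambda>_. indicator A"]) auto
qed

text \<open>
  By the isometry, the integrals of any approximating simple functions converge in \<open>L\<^sup>2\<close> to
  \<open>W A\<close> as well as to \<open>I\<close>.
\<close>

lemma has_gaussian_integral_indicator_unique:
  assumes "prob_space P" and W: "gaussian_random_measure P m W"
    and A: "A \<in> sets m" "emeasure m A < \<infinity>"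
    and f: "AE z in m. f z = indicator A z" and I: "has_gaussian_integral P m W f I"
  shows "AE \<omega> in P. I \<omega> = W A \<omega>"
proof -
  obtain s where s: "\<And>n. Bochner_Integration.simple_bochner_integrable m (s n)"
    and sf: "(\<lambda>n. \<integral>\<^sup>+z. ennreal ((s n z - f z)\<^sup>2) \<partial>m) \<longlonglongrightarrow> 0"
    and sI: "(\<lambda>n. \<integral>\<^sup>+\<omega>. ennreal ((simple_gaussian_integral m W (s n) \<omega> - I \<omega>)\<^sup>2) \<partial>P) \<longlonglongrightarrow> 0"
    and [measurable]: "I \<in> borel_measurable P"
    using I unfolding has_gaussian_integral_def by blast
  have [measurable]: "W A \<in> borel_measurable P"
    using W A by (rule gaussian_random_measure_borel)
  have [measurable]: "simple_gaussian_integral m W (s n) \<in> borel_measurable P" for n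
    unfolding simple_gaussian_integral_def
  proof (intro borel_measurable_sum)
    fix y
    show "(\<lambda>\<omega>. y * W {z\<in>space m. s n z = y} \<omega>) \<in> borel_measurable P"
      using simple_bochner_integrable_level_set[OF s[of n], of y]
        gaussian_random_measure_borel[OF W, of "{z\<in>space m. s n z = y}"] by (cases "y = 0") auto
  qed
  have "(\<integral>\<^sup>+z. ennreal ((s n z - f z)\<^sup>2) \<partial>m) =
      (\<integral>\<^sup>+\<omega>. ennreal ((simple_gaussian_integral m W (s n) \<omega> - W A \<omega>)\<^sup>2) \<partial>P)" for n
    unfolding simple_gaussian_integral_isometry[OF assms(1) W s A]
    using f by (intro nn_integral_cong_AE) auto
  with sf have sW: "(\<lambda>n. \<integral>\<^sup>+\<omega>. ennreal ((simple_gaussian_integral m W (s n) \<omega> - W A \<omega>)\<^sup>2) \<partial>P) \<longlonglongrightarrow> 0"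
    by simp
  have "(\<lambda>n. 2 * (\<integral>\<^sup>+\<omega>. ennreal ((I \<omega> - simple_gaussian_integral m W (s n) \<omega>)\<^sup>2) \<partial>P) +
      2 * (\<integral>\<^sup>+\<omega>. ennreal ((simple_gaussian_integral m W (s n) \<omega> - W A \<omega>)\<^sup>2) \<partial>P)) \<longlonglongrightarrow> 2 * 0 + 2 * 0"
    using sI sW by (intro tendsto_add ennreal_tendsto_cmult) (simp_all add: power2_commute)
  moreover have "(\<integral>\<^sup>+\<omega>. ennreal ((I \<omega> - W A \<omega>)\<^sup>2) \<partial>P) \<le>
      2 * (\<integral>\<^sup>+\<omega>. ennreal ((I \<omega> - simple_gaussian_integral m W (s n) \<omega>)\<^sup>2) \<partial>P) +
      2 * (\<integral>\<^sup>+\<omega>. ennreal ((simple_gaussian_integral m W (s n) \<omega> - W A \<omega>)\<^sup>2) \<partial>P)" for n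
    using nn_integral_square_add_le[of "\<lambda>\<omega>. I \<omega> - simple_gaussian_integral m W (s n) \<omega>" P
      "\<lambda>\<omega>. simple_gaussian_integral m W (s n) \<omega> - W A \<omega>"] by simp
  ultimately have "(\<integral>\<^sup>+\<omega>. ennreal ((I \<omega> - W A \<omega>)\<^sup>2) \<partial>P) \<le> 2 * 0 + 2 * 0"
    by (intro LIMSEQ_le_const) auto
  then have "AE \<omega> in P. ennreal ((I \<omega> - W A \<omega>)\<^sup>2) = 0"
    by (subst (asm) mult_zero_right, subst nn_integral_0_iff_AE[symmetric]) auto
  then show ?thesis by eventually_elim (simp add: ennreal_eq_0_iff)
qed

section \<open>Fractional Brownian motion reaches every level\<close>

lemma fractional_brownian_motionD:
  assumes "fractional_brownian_motion P H \<sigma> Y"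
  shows fractional_brownian_motion_hurst: "0 < H" "H < 1" "0 < \<sigma>"
    and fractional_brownian_motion_borel: "0 \<le> t \<Longrightarrow> Y t \<in> borel_measurable P"
    and fractional_brownian_motion_cov: "0 \<le> s \<Longrightarrow> 0 \<le> t \<Longrightarrow> (\<integral>\<omega>. Y s \<omega> * Y t \<omega> \<partial>P) =
        \<sigma>\<^sup>2 / 2 * (s powr (2 * H) + t powr (2 * H) - \<bar>t - s\<bar> powr (2 * H))"
    and fractional_brownian_motion_zero: "\<omega> \<in> space P \<Longrightarrow> Y 0 \<omega> = 0"
    and fractional_brownian_motion_continuous: "\<omega> \<in> space P \<Longrightarrow> continuous_on {0..} (\<lambda>t. Y t \<omega>)"
  using assms unfolding fractional_brownian_motion_def centered_gaussian_process_def by auto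

lemma centered_gaussian_process_pair:
  assumes X: "centered_gaussian_process P T X" and "s \<in> T" "t \<in> T"
  shows "\<exists>v\<ge>0. distr P borel (\<lambda>\<omega>. a * X s \<omega> + b * X t \<omega>) = normal_law 0 v"
proof (cases "s = t")
  case True
  have "\<exists>v\<ge>0. distr P borel (\<lambda>\<omega>. \<Sum>r\<in>{s}. (a + b) * X r \<omega>) = normal_law 0 v"
    using X \<open>s \<in> T\<close> unfolding centered_gaussian_process_def by (elim conjE allE[of _ "{s}"] allE[of _ "\<lambda>_. a + b"]) auto
  then show ?thesis using True by (simp add: distrib_right)
next
  case False
  have "\<exists>v\<ge>0. distr P borel (\<lambda>\<omega>. \<Sum>r\<in>{s, t}. (if r = s then a else b) * X r \<omega>) = normal_law 0 v"
    using X assms(2,3) unfolding centered_gaussian_process_def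
    by (elim conjE allE[of _ "{s, t}"] allE[of _ "\<lambda>r. if r = s then a else b"]) auto
  then show ?thesis using False by simp
qed

text \<open>
  Dividing by \<open>x powr H * y powr H\<close> makes this a bound on the correlation of fractional Brownian motion at
  the times \<open>x\<close> and \<open>y\<close>, which is small when \<open>x / y\<close> is small. By scaling it reduces to
  \<open>1 - (1 - r) powr (2 * H) \<le> 2 * r\<close> for \<open>r = x / y\<close>, and this follows from
  \<open>(1 - r) powr (2 * H) \<ge> (1 - r)\<^sup>2\<close> because \<open>H < 1\<close>.
\<close>

lemma fractional_covariance_bounds:
  fixes x y H :: real
  assumes "0 < H" "H < 1" and "0 < x" "x \<le> y"
  shows "0 \<le> x powr (2 * H) + y powr (2 * H) - (y - x) powr (2 * H)"
    and "x powr (2 * H) + y powr (2 * H) - (y - x) powr (2 * H) \<le>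
      2 * (x powr H * y powr H) * ((x / y) powr H + (x / y) powr (1 - H))"
proof -
  have "(y - x) powr (2 * H) \<le> y powr (2 * H)"
    using assms by (intro powr_mono2) auto
  then show "0 \<le> x powr (2 * H) + y powr (2 * H) - (y - x) powr (2 * H)"
    by (simp add: add_increasing)
  define r where "r = x / y"
  have y: "0 < y" using assms by simp
  have r: "0 < r" "r \<le> 1" using assms y by (simp_all add: r_def)
  have x: "x = r * y" using y by (simp add: r_def)
  have "1 - 2 * r \<le> (1 - r) powr (2 * H)"
  proof (cases "r = 1")
    case False
    then have r1: "0 < 1 - r" using r by simp
    have "1 - 2 * r \<le> (1 - r)\<^sup>2" by (simp add: power2_eq_square algebra_simps)
    also have "\<dots> = (1 - r) powr 2" using r1 by (simp add: powr_numeral)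
    also have "\<dots> \<le> (1 - r) powr (2 * H)"
      using assms r1 r by (intro powr_mono') auto
    finally show ?thesis .
  qed simp
  then have "r powr (2 * H) + 1 - (1 - r) powr (2 * H) \<le> r powr (2 * H) + 2 * r"
    by simp
  also have "\<dots> \<le> 2 * (r powr (2 * H) + r)"
    by simp
  also have "r powr (2 * H) + r = r powr H * (r powr H + r powr (1 - H))"
    using r by (simp add: distrib_left flip: powr_add)
  finally have "(r powr (2 * H) + 1 - (1 - r) powr (2 * H)) * y powr (2 * H) \<le>
      2 * (r powr H * (r powr H + r powr (1 - H))) * y powr (2 * H)"
    by (rule mult_right_mono) simp
  moreover have "x powr (2 * H) = r powr (2 * H) * y powr (2 * H)"
    unfolding x using r y by (simp add: powr_mult)
  moreover have "(y - x) powr (2 * H) = (1 - r) powr (2 * H) * y powr (2 * H)"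
  proof -
    have "y - x = (1 - r) * y" by (simp add: x algebra_simps)
    then show ?thesis using r y by (simp add: powr_mult)
  qed
  moreover have "x powr H * y powr H = r powr H * y powr (2 * H)"
    unfolding x using r y by (simp add: powr_mult mult.assoc flip: powr_add)
  ultimately show "x powr (2 * H) + y powr (2 * H) - (y - x) powr (2 * H) \<le>
      2 * (x powr H * y powr H) * ((x / y) powr H + (x / y) powr (1 - H))"
    by (simp add: r_def[symmetric] algebra_simps)
qed

text \<open>
  At geometric times, the ratio of two distinct times is at most \<open>1 / R\<close>, so \<open>\<delta>\<close> bounds all
  correlations at once. The times start at \<open>R\<close> and not at \<open>1\<close>, so that the normalized level is at most
  \<open>s / (\<sigma> * R powr H)\<close>, small for large \<open>R\<close>.
\<close>

lemma fractional_brownian_motion_below_at_powers: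
  fixes n :: nat
  assumes "prob_space P" and Y: "fractional_brownian_motion P H \<sigma> Y"
    and "1 < R" and "0 < n"
    and \<delta>: "\<delta> = (1 / R) powr H + (1 / R) powr (1 - H)" "\<delta> \<le> 1"
    and "0 \<le> s" and s: "s / (\<sigma> * R powr H) \<le> (1 - exp (- 1 / 2)) / 4"
  shows "measure P {\<omega>\<in>space P. \<forall>k<n. Y (R ^ Suc k) \<omega> \<le> s} \<le>
    16 / (1 - exp (- 1 / 2))\<^sup>2 * (1 / n + \<delta>)"
proof -
  interpret prob_space P by fact
  note H = fractional_brownian_motion_hurst[OF Y]
  have gp: "centered_gaussian_process P {0..} Y"
    using Y by (simp add: fractional_brownian_motion_def)
  define t where "t k = R ^ Suc k" for k
  have tR: "R \<le> t k" for k
    using \<open>1 < R\<close> by (simp add: t_def)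
  have t: "0 < t k" for k
    using tR[of k] \<open>1 < R\<close> by simp
  define a where "a k = 1 / (\<sigma> * t k powr H)" for k
  have a: "0 < a k" for k using H t[of k] by (simp add: a_def)
  define Z where "Z k \<omega> = a k * Y (t k) \<omega>" for k \<omega>
  have Z[measurable]: "Z k \<in> borel_measurable P" for k
    unfolding Z_def using t[of k]
    by (intro borel_measurable_times borel_measurable_const fractional_brownian_motion_borel[OF Y]) auto
  have comb: "\<exists>v\<ge>0. distr P borel (\<lambda>\<omega>. b * Z j \<omega> + c * Z k \<omega>) = normal_law 0 v" for b c j k
    using centered_gaussian_process_pair[OF gp, of "t j" "t k" "b * a j" "c * a k"] t[of j] t[of k]
    by (simp add: Z_def mult.assoc)
  have cov: "(\<integral>\<omega>. Z j \<omega> * Z k \<omega> \<partial>P) =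
      (t j powr (2 * H) + t k powr (2 * H) - \<bar>t k - t j\<bar> powr (2 * H)) / (2 * (t j powr H * t k powr H))" for j k
  proof -
    have "(\<integral>\<omega>. Z j \<omega> * Z k \<omega> \<partial>P) = (\<integral>\<omega>. (a j * a k) * (Y (t j) \<omega> * Y (t k) \<omega>) \<partial>P)"
      by (simp add: Z_def mult_ac)
    also have "\<dots> = a j * a k * (\<sigma>\<^sup>2 / 2 * (t j powr (2 * H) + t k powr (2 * H) - \<bar>t k - t j\<bar> powr (2 * H)))"
      using t by (simp add: fractional_brownian_motion_cov[OF Y] less_imp_le)
    also have "\<dots> = (t j powr (2 * H) + t k powr (2 * H) - \<bar>t k - t j\<bar> powr (2 * H)) / (2 * (t j powr H * t k powr H))"
      using H by (simp add: a_def power2_eq_square)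
    finally show ?thesis .
  qed
  have std: "distr P borel (Z k) = normal_law 0 1" for k
  proof -
    obtain v where v: "0 \<le> v" "distr P borel (Z k) = normal_law 0 v"
      using comb[of 1 k 0 k] by auto
    have "v = (\<integral>\<omega>. Z k \<omega> * Z k \<omega> \<partial>P)"
      using normal_law_integral_square[OF assms(1) Z v(2,1)] by (simp add: power2_eq_square)
    also have "\<dots> = 1"
      unfolding cov using t[of k] by (simp flip: powr_add)
    finally show ?thesis using v by simp
  qed
  have less: "0 \<le> (\<integral>\<omega>. Z j \<omega> * Z k \<omega> \<partial>P) \<and> (\<integral>\<omega>. Z j \<omega> * Z k \<omega> \<partial>P) \<le> \<delta>" if "j < k" for j k
  proof -
    have "t j * R = R ^ Suc (Suc j)" by (simp add: t_def)
    also have "\<dots> \<le> t k" unfolding t_def using that \<open>1 < R\<close> by (intro power_increasing) auto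
    finally have jk: "t j * R \<le> t k" .
    have le: "t j \<le> t k"
      using that \<open>1 < R\<close> unfolding t_def by (intro power_increasing) auto
    have r: "t j / t k \<le> 1 / R"
      using jk t[of k] \<open>1 < R\<close> by (simp add: field_simps)
    let ?N = "t j powr (2 * H) + t k powr (2 * H) - (t k - t j) powr (2 * H)"
    let ?D = "2 * (t j powr H * t k powr H)"
    have D: "0 < ?D" using t[of j] t[of k] by simp
    have "0 \<le> ?N" "?N \<le> ?D * ((t j / t k) powr H + (t j / t k) powr (1 - H))"
      by (rule fractional_covariance_bounds[OF H(1,2) t le])+
    then have "0 \<le> ?N / ?D" "?N / ?D \<le> (t j / t k) powr H + (t j / t k) powr (1 - H)"
      using D by (auto simp add: pos_divide_le_eq mult.commute simp del: times_divide_eq_left)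
    moreover have "(t j / t k) powr H + (t j / t k) powr (1 - H) \<le> \<delta>"
      unfolding \<delta>(1) using H r t[of j] t[of k] by (intro add_mono powr_mono2) auto
    ultimately show ?thesis unfolding cov using le by simp
  qed
  have sub: "{\<omega>\<in>space P. \<forall>k<n. Y (R ^ Suc k) \<omega> \<le> s} \<subseteq>
      {\<omega>\<in>space P. \<forall>k<n. Z k \<omega> \<le> s / (\<sigma> * R powr H)}"
  proof safe
    fix \<omega> k assume "\<forall>k<n. Y (R ^ Suc k) \<omega> \<le> s" "k < n"
    then have "Y (t k) \<omega> \<le> s" by (simp add: t_def)
    then have "Z k \<omega> \<le> a k * s" unfolding Z_def using a[of k] by (intro mult_left_mono) auto
    also have "\<dots> = s / (\<sigma> * t k powr H)" by (simp add: a_def)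
    also have "\<dots> \<le> s / (\<sigma> * R powr H)"
      using H tR[of k] \<open>1 < R\<close> \<open>0 \<le> s\<close> by (intro divide_left_mono mult_left_mono powr_mono2 mult_pos_pos) auto
    finally show "Z k \<omega> \<le> s / (\<sigma> * R powr H)" .
  qed
  have "measure P {\<omega>\<in>space P. \<forall>k<n. Y (R ^ Suc k) \<omega> \<le> s} \<le>
      measure P {\<omega>\<in>space P. \<forall>k<n. Z k \<omega> \<le> s / (\<sigma> * R powr H)}"
    by (rule finite_measure_mono[OF sub]) measurable
  also have "\<dots> \<le> 16 / (1 - exp (- 1 / 2))\<^sup>2 * (1 / n + \<delta>)"
  proof (rule weakly_correlated_normal_all_le)
    show "\<exists>v\<ge>0. distr P borel (\<lambda>\<omega>. Z j \<omega> + Z k \<omega>) = normal_law 0 v" for j k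
      using comb[of 1 j 1 k] by simp
    show "\<exists>v\<ge>0. distr P borel (\<lambda>\<omega>. Z j \<omega> - Z k \<omega>) = normal_law 0 v" for j k
      using comb[of 1 j "-1" k] by simp
    show "0 \<le> (\<integral>\<omega>. Z j \<omega> * Z k \<omega> \<partial>P) \<and> (\<integral>\<omega>. Z j \<omega> * Z k \<omega> \<partial>P) \<le> \<delta>" if "j \<noteq> k" for j k
      using less[of j k] less[of k j] that by (cases "j < k") (auto simp: mult.commute)
  qed (use std \<delta> s \<open>0 < n\<close> \<open>1 < R\<close> assms(1) in auto)
  finally show ?thesis .
qed

lemma continuous_path_hits_level:
  fixes f :: "real \<Rightarrow> real"
  assumes "continuous_on {0..} f" and "f 0 \<le> s" "s \<le> f t" "0 \<le> t"
  shows "\<exists>r\<ge>0. f r = s"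
proof -
  have "continuous_on {0..t} f"
    using assms(1) by (rule continuous_on_subset) auto
  then show ?thesis using IVT'[of f 0 s t] assms by auto
qed

text \<open>
  The bound at geometric times, with ratio and number of times both equal to \<open>N\<close>, tends to \<open>0\<close>. It holds
  for the event that \<open>Y\<close> is at most \<open>s\<close> at all times \<open>m ^ n\<close>, which does not depend on \<open>N\<close> and is therefore a
  null set. Off it the intermediate value theorem gives a hitting time.
\<close>

theorem fractional_brownian_motion_hits_level:
  assumes "prob_space P" and Y: "fractional_brownian_motion P H \<sigma> Y" and "0 \<le> s"
  shows "AE \<omega> in P. \<exists>t\<ge>0. Y t \<omega> = s"
proof -
  interpret prob_space P by fact
  note H = fractional_brownian_motion_hurst[OF Y]
  define D where "D = {\<omega>\<in>space P. \<forall>m n :: nat. Y (real m ^ n) \<omega> \<le> s}"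
  have [measurable]: "Y (real m ^ n) \<in> borel_measurable P" for m n
    by (intro fractional_brownian_motion_borel[OF Y]) simp
  have D[measurable]: "D \<in> sets P" unfolding D_def by measurable
  define \<delta> where "\<delta> N = (1 / real N) powr H + (1 / real N) powr (1 - H)" for N
  have powr0: "(\<lambda>N. (1 / real N) powr p) \<longlonglongrightarrow> 0" if "0 < p" for p
    using that by (intro tendsto_zero_powrI[OF lim_1_over_n tendsto_const]) auto
  have \<delta>0: "\<delta> \<longlonglongrightarrow> 0"
    unfolding \<delta>_def using tendsto_add[OF powr0 powr0, of H "1 - H"] H by simp
  have ev1: "\<forall>\<^sub>F N in sequentially. \<delta> N \<le> 1"
    using order_tendstoD(2)[OF \<delta>0, of 1] by (auto elim: eventually_mono)
  have "(\<lambda>N. s / (\<sigma> * real N powr H)) \<longlonglongrightarrow> 0"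
    using tendsto_mult_right_zero[OF powr0[OF H(1)], of "s / \<sigma>"] by (simp add: powr_divide)
  then have ev2: "\<forall>\<^sub>F N in sequentially. s / (\<sigma> * real N powr H) < (1 - exp (- 1 / 2)) / 4"
    by (rule order_tendstoD) simp
  have "\<forall>\<^sub>F N in sequentially. measure P D \<le> 16 / (1 - exp (- 1 / 2))\<^sup>2 * (1 / N + \<delta> N)"
    using ev1 ev2 eventually_gt_at_top[of 1]
  proof eventually_elim
    case (elim N)
    have "measure P D \<le> measure P {\<omega>\<in>space P. \<forall>k<N. Y (real N ^ Suc k) \<omega> \<le> s}"
      by (intro finite_measure_mono) (auto simp: D_def simp del: power_Suc)
    also have "\<dots> \<le> 16 / (1 - exp (- 1 / 2))\<^sup>2 * (1 / N + \<delta> N)"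
      using elim \<open>0 \<le> s\<close>
      by (intro fractional_brownian_motion_below_at_powers[OF assms(1) Y]) (auto simp: \<delta>_def)
    finally show ?case .
  qed
  moreover have "(\<lambda>N. 16 / (1 - exp (- 1 / 2))\<^sup>2 * (1 / real N + \<delta> N)) \<longlonglongrightarrow>
      16 / (1 - exp (- 1 / 2))\<^sup>2 * (0 + 0)"
    by (intro tendsto_mult tendsto_const tendsto_add \<delta>0 lim_1_over_n)
  ultimately have "measure P D \<le> 16 / (1 - exp (- 1 / 2))\<^sup>2 * (0 + 0)"
    by (intro tendsto_lowerbound[where F = sequentially]) auto
  then have "measure P D = 0" using measure_nonneg[of P D] by (simp add: order_antisym)
  then have "AE \<omega> in P. \<omega> \<notin> D"
    by (simp add: prob_eq_0)
  then show ?thesis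
    using AE_space
  proof eventually_elim
    case (elim \<omega>)
    then obtain m n :: nat where "s \<le> Y (real m ^ n) \<omega>"
      by (auto simp: D_def not_le intro: less_imp_le)
    then show ?case
      using continuous_path_hits_level[OF fractional_brownian_motion_continuous[OF Y], of \<omega> s "real m ^ n"]
        fractional_brownian_motion_zero[OF Y] elim \<open>0 \<le> s\<close> by simp
  qed
qed

section \<open>Hitting times and the time change\<close>

lemma level_hitting_time_finite_iff:
  "level_hitting_time Y s \<omega> < \<infinity> \<longleftrightarrow> (\<exists>t\<ge>0. Y t \<omega> = s)"
  unfolding level_hitting_time_def Inf_less_iff by auto

text \<open>
  The first hitting time is attained because the set of hitting times is closed. On a path that never
  reaches \<open>s\<close> the infinite hitting time is read as time \<open>0\<close>.
\<close>

lemma time_change_level_hitting_time: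
  assumes cont: "continuous_on {0..} (\<lambda>t. Y t \<omega>)" and "Y 0 \<omega> = 0"
  shows "time_change Y (level_hitting_time Y) s \<omega> = (if \<exists>t\<ge>0. Y t \<omega> = s then s else 0)"
proof (cases "\<exists>t\<ge>0. Y t \<omega> = s")
  case True
  define S where "S = {t. 0 \<le> t \<and> Y t \<omega> = s}"
  have "S \<noteq> {}" "bdd_below S" using True by (auto simp: S_def)
  moreover have "S = {0..} \<inter> (\<lambda>t. Y t \<omega>) -` {s}" by (auto simp: S_def)
  then have "closed S" using continuous_closed_preimage[OF cont, of "{s}"] by simp
  ultimately have "Inf S \<in> S" by (intro closed_contains_Inf)
  moreover have "level_hitting_time Y s \<omega> = ereal (Inf S)"
    unfolding level_hitting_time_def S_def[symmetric]
    using ereal_Inf'[of S] \<open>S \<noteq> {}\<close> \<open>bdd_below S\<close> by simp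
  ultimately show ?thesis using True by (simp add: time_change_def S_def)
next
  case False
  then have "\<not> level_hitting_time Y s \<omega> < \<infinity>"
    unfolding level_hitting_time_finite_iff .
  then have "level_hitting_time Y s \<omega> = \<infinity>" by simp
  then show ?thesis
    unfolding if_not_P[OF False] using assms(2) by (simp add: time_change_def)
qed

text \<open>
  Restates the hitting event by countably many conditions, which makes it measurable. On a compact interval a
  continuous function that comes arbitrarily close to \<open>s\<close> from below has a maximum of at least \<open>s\<close>; the
  bound \<open>N\<close> therefore has to be chosen before \<open>n\<close>. The absolute value keeps the rational times
  nonnegative.
\<close>

lemma continuous_path_hits_level_iff:
  fixes f :: "real \<Rightarrow> real"
  assumes cont: "continuous_on {0..} f" and "f 0 \<le> s"
  shows "(\<exists>t\<ge>0. f t = s) \<longleftrightarrow>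
    (\<exists>N::nat. \<forall>n::nat. \<exists>q::rat. \<bar>of_rat q\<bar> \<le> real N \<and> s - 1 / real (Suc n) < f \<bar>of_rat q\<bar>)"
proof
  assume "\<exists>t\<ge>0. f t = s"
  then obtain t where t: "0 \<le> t" "f t = s" by auto
  obtain N :: nat where N: "t + 1 \<le> real N" using real_arch_simple by blast
  show "\<exists>N::nat. \<forall>n::nat. \<exists>q::rat. \<bar>of_rat q\<bar> \<le> real N \<and> s - 1 / real (Suc n) < f \<bar>of_rat q\<bar>"
  proof (intro exI[of _ N] allI)
    fix n :: nat
    obtain d where d: "0 < d" "\<And>x. 0 \<le> x \<Longrightarrow> dist x t < d \<Longrightarrow> dist (f x) (f t) < 1 / real (Suc n)"
      using cont t unfolding continuous_on_iff
      by (metis atLeast_iff of_nat_0_less_iff zero_less_Suc zero_less_divide_1_iff)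
    obtain q where q: "t < of_rat q" "of_rat q < t + min d 1"
      using of_rat_dense[of t "t + min d 1"] d(1) by auto
    have q0: "0 \<le> (of_rat q :: real)" using q t by linarith
    have "dist (f (of_rat q)) (f t) < 1 / real (Suc n)"
      using q q0 by (intro d) (simp_all add: dist_real_def)
    then show "\<exists>q::rat. \<bar>of_rat q\<bar> \<le> real N \<and> s - 1 / real (Suc n) < f \<bar>of_rat q\<bar>"
      using q q0 t N by (intro exI[of _ q]) (simp add: dist_real_def abs_less_iff)
  qed
next
  assume "\<exists>N::nat. \<forall>n::nat. \<exists>q::rat. \<bar>of_rat q\<bar> \<le> real N \<and> s - 1 / real (Suc n) < f \<bar>of_rat q\<bar>"
  then obtain N :: nat
    where N: "\<And>n::nat. \<exists>q::rat. \<bar>of_rat q\<bar> \<le> real N \<and> s - 1 / real (Suc n) < f \<bar>of_rat q\<bar>"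
    by blast
  have "continuous_on {0..real N} f"
    using cont by (rule continuous_on_subset) auto
  then obtain t where t: "t \<in> {0..real N}" "\<And>x. x \<in> {0..real N} \<Longrightarrow> f x \<le> f t"
    using continuous_attains_sup[of "{0..real N}" f] by auto
  have "s \<le> f t"
  proof (rule ccontr)
    assume "\<not> s \<le> f t"
    then obtain n where n: "1 / real (Suc n) < s - f t"
      using nat_approx_posE[of "s - f t"] by auto
    obtain q where "\<bar>of_rat q\<bar> \<le> real N" "s - 1 / real (Suc n) < f \<bar>of_rat q\<bar>"
      using N by blast
    with n t(2)[of "\<bar>of_rat q\<bar>"] show False by simp
  qed
  then show "\<exists>t\<ge>0. f t = s"
    using continuous_path_hits_level[OF cont \<open>f 0 \<le> s\<close>, of t] t by simp
qed

lemma fractional_brownian_motion_hits_level_sets: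
  assumes Y: "fractional_brownian_motion P H \<sigma> Y" and "0 \<le> s"
  shows "{\<omega>\<in>space P. \<exists>t\<ge>0. Y t \<omega> = s} \<in> sets P"
proof -
  have [measurable]: "Y \<bar>t\<bar> \<in> borel_measurable P" for t
    by (intro fractional_brownian_motion_borel[OF Y]) simp
  have "{\<omega>\<in>space P. \<exists>t\<ge>0. Y t \<omega> = s} = {\<omega>\<in>space P.
      \<exists>N::nat. \<forall>n::nat. \<exists>q::rat. \<bar>of_rat q\<bar> \<le> real N \<and> s - 1 / real (Suc n) < Y \<bar>of_rat q\<bar> \<omega>}"
    using continuous_path_hits_level_iff[OF fractional_brownian_motion_continuous[OF Y], of _ s]
      fractional_brownian_motion_zero[OF Y] \<open>0 \<le> s\<close>
    by (intro Collect_cong conj_cong refl) simp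
  also have "\<dots> \<in> sets P" by measurable
  finally show ?thesis .
qed

section \<open>Brownian motion from the masses of strips\<close>

text \<open>
  Independence is a property of the joint law, and the joint law of finitely many variables does not see null
  sets.
\<close>

lemma (in prob_space) indep_vars_cong_AE:
  assumes X: "indep_vars N X I" and "finite I"
    and Y: "\<And>i. i \<in> I \<Longrightarrow> Y i \<in> measurable M (N i)"
    and eq: "\<And>i. i \<in> I \<Longrightarrow> AE \<omega> in M. X i \<omega> = Y i \<omega>"
  shows "indep_vars N Y I"
proof (cases "I = {}")
  case True
  then show ?thesis using X by (simp add: indep_vars_def indep_sets_def)
next
  case False
  have X': "X i \<in> measurable M (N i)" if "i \<in> I" for i
    using X that by (auto simp: indep_vars_def)
  have "AE \<omega> in M. \<forall>i\<in>I. X i \<omega> = Y i \<omega>"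
    using eq \<open>finite I\<close> by (simp add: AE_ball_countable countable_finite)
  then have "AE \<omega> in M. (\<lambda>i\<in>I. Y i \<omega>) = (\<lambda>i\<in>I. X i \<omega>)"
    by eventually_elim (auto simp: fun_eq_iff)
  then have "distr M (PiM I N) (\<lambda>\<omega>. \<lambda>i\<in>I. Y i \<omega>) = distr M (PiM I N) (\<lambda>\<omega>. \<lambda>i\<in>I. X i \<omega>)"
    using X' Y by (intro distr_cong_AE) (auto intro!: measurable_restrict)
  also have "\<dots> = PiM I (\<lambda>i. distr M (N i) (X i))"
    using X indep_vars_iff_distr_eq_PiM'[OF False X'] by simp
  also have "\<dots> = PiM I (\<lambda>i. distr M (N i) (Y i))"
    using X' Y eq by (intro PiM_cong distr_cong_AE) auto
  finally show ?thesis
    using indep_vars_iff_distr_eq_PiM'[OF False Y] by simp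
qed

lemma emeasure_prob_times_interval:
  assumes "prob_space Q" and "a \<le> b"
  shows "emeasure (Q \<Otimes>\<^sub>M lborel) (space Q \<times> {a<..b}) = ennreal (b - a)"
    and "emeasure (Q \<Otimes>\<^sub>M lborel) (space Q \<times> {a..b}) = ennreal (b - a)"
  using assms by (simp_all add: lborel.emeasure_pair_measure_Times prob_space.emeasure_space_1)

text \<open>
  Additivity turns the increment over \<open>(s, t]\<close> into the mass of the strip above \<open>(s, t]\<close>.
\<close>

lemma brownian_motion_fdd_of_strips:
  assumes "prob_space P" "prob_space Q"
    and W: "gaussian_random_measure P (Q \<Otimes>\<^sub>M lborel) W"
    and B: "\<And>t. 0 \<le> t \<Longrightarrow> B t \<in> borel_measurable P"
    and BW: "\<And>t. 0 \<le> t \<Longrightarrow> AE \<omega> in P. B t \<omega> = W (space Q \<times> {0..t}) \<omega>"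
  shows "brownian_motion_fdd P B"
proof -
  interpret P: prob_space P by fact
  note em = emeasure_prob_times_interval[OF assms(2)]
  have sets: "space Q \<times> {a<..b} \<in> sets (Q \<Otimes>\<^sub>M lborel)" "space Q \<times> {a..b} \<in> sets (Q \<Otimes>\<^sub>M lborel)" for a b :: real
    by (auto intro!: pair_measureI)
  have Wb: "W (space Q \<times> {s<..t}) \<in> borel_measurable P" if "s \<le> t" for s t :: real
    using em[OF that] by (intro gaussian_random_measure_borel[OF W] sets) simp
  have incr: "AE \<omega> in P. W (space Q \<times> {s<..t}) \<omega> = B t \<omega> - B s \<omega>" if "0 \<le> s" "s \<le> t" for s t
  proof -
    have "space Q \<times> {0..s} \<union> space Q \<times> {s<..t} = space Q \<times> {0..t}"
      and dis: "space Q \<times> {0..s} \<inter> space Q \<times> {s<..t} = {}" using that by auto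
    then have "AE \<omega> in P. W (space Q \<times> {0..t}) \<omega> = W (space Q \<times> {0..s}) \<omega> + W (space Q \<times> {s<..t}) \<omega>"
      using gaussian_random_measure_Un[OF W sets(2) _ sets(1) _ dis] em[of 0 s] em[of s t] that by auto
    with BW[of s] BW[of t] show ?thesis
      using that by auto
  qed
  have law: "distr P borel (\<lambda>\<omega>. B t \<omega> - B s \<omega>) = normal_law 0 (t - s)" if st: "0 \<le> s" "s \<le> t" for s t
  proof -
    have "distr P borel (\<lambda>\<omega>. B t \<omega> - B s \<omega>) = distr P borel (W (space Q \<times> {s<..t}))"
      using incr[OF st] Wb[OF st(2)] B[of s] B[of t] st by (intro distr_cong_AE) auto
    also have "\<dots> = normal_law 0 (t - s)"
      using gaussian_random_measure_law[OF W sets(1), of s t] em[OF st(2)] st by (simp add: measure_def)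
    finally show ?thesis .
  qed
  have indep: "P.indep_vars (\<lambda>_. borel) (\<lambda>i \<omega>. B (t (Suc i)) \<omega> - B (t i) \<omega>) {..<n}"
    if t0: "0 \<le> t 0" and nondec: "\<forall>i<n. t i \<le> t (Suc i)" for n :: nat and t :: "nat \<Rightarrow> real"
  proof (rule P.indep_vars_cong_AE)
    have mono: "t i \<le> t j" if "i \<le> j" "j \<le> n" for i j
      using that
    proof (induction j rule: dec_induct)
      case (step k)
      then have "t i \<le> t k" "t k \<le> t (Suc k)" using nondec by auto
      then show ?case by simp
    qed simp
    have pos: "0 \<le> t i" if "i \<le> n" for i
      using mono[of 0 i] t0 that by simp
    have "disjoint_family_on (\<lambda>i. space Q \<times> {t i<..t (Suc i)}) {..<n}"
      unfolding disjoint_family_on_def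
    proof (intro ballI impI)
      fix i j assume ij: "i \<in> {..<n}" "j \<in> {..<n}" "i \<noteq> j"
      then have "t (Suc i) \<le> t j \<or> t (Suc j) \<le> t i"
        using mono[of "Suc i" j] mono[of "Suc j" i] by (cases "i < j") auto
      then show "space Q \<times> {t i<..t (Suc i)} \<inter> space Q \<times> {t j<..t (Suc j)} = {}" by auto
    qed
    then show "P.indep_vars (\<lambda>_. borel) (\<lambda>i. W (space Q \<times> {t i<..t (Suc i)})) {..<n}"
      using nondec em by (intro gaussian_random_measure_indep[OF W] sets) simp_all
    show "AE \<omega> in P. W (space Q \<times> {t i<..t (Suc i)}) \<omega> = B (t (Suc i)) \<omega> - B (t i) \<omega>" if "i \<in> {..<n}" for i
      using that nondec pos[of i] by (intro incr) auto
    show "(\<lambda>\<omega>. B (t (Suc i)) \<omega> - B (t i) \<omega>) \<in> borel_measurable P" if "i \<in> {..<n}" for i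
      using that pos[of i] pos[of "Suc i"] by (intro borel_measurable_diff B) auto
  qed simp
  have "AE \<omega> in P. W (space Q \<times> {0..0}) \<omega> = 0"
    using em[of 0 0] by (intro gaussian_random_measure_null[OF W] sets) simp
  with BW[of 0] have "AE \<omega> in P. B 0 \<omega> = 0" by auto
  then show ?thesis
    unfolding brownian_motion_fdd_def using B law indep by blast
qed

text \<open>
  Measurability of the kernel makes an integral exist, so that the arbitrarily selected version is one; by
  uniqueness it does not matter which version is selected.
\<close>

lemma segment_integral_process_AE_strip:
  assumes "prob_space P" "prob_space Q"
    and W: "gaussian_random_measure P (Q \<Otimes>\<^sub>M lborel) W" and "0 \<le> t"
    and Z[measurable]: "Z t \<in> borel_measurable Q" and Zt: "AE \<omega>' in Q. Z t \<omega>' = t"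
  shows "segment_integral_process P Q W Z t \<in> borel_measurable P"
    and "AE \<omega> in P. segment_integral_process P Q W Z t \<omega> = W (space Q \<times> {0..t}) \<omega>"
proof -
  interpret Q: prob_space Q by fact
  interpret pair_sigma_finite Q lborel ..
  define f where "f = (\<lambda>(\<omega>', x). indicator (closed_segment 0 (Z t \<omega>')) x :: real)"
  have "f = (\<lambda>p. if (0 \<le> snd p \<and> snd p \<le> Z t (fst p)) \<or> (Z t (fst p) \<le> snd p \<and> snd p \<le> 0) then 1 else 0)"
    by (auto simp: f_def fun_eq_iff closed_segment_eq_real_ivl indicator_def)
  then have f: "f \<in> borel_measurable (Q \<Otimes>\<^sub>M lborel)" by simp
  define A where "A = space Q \<times> {0..t}"
  have A[measurable]: "A \<in> sets (Q \<Otimes>\<^sub>M lborel)" "emeasure (Q \<Otimes>\<^sub>M lborel) A < \<infinity>"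
    using emeasure_prob_times_interval(2)[OF assms(2) \<open>0 \<le> t\<close>] by (auto simp: A_def intro!: pair_measureI)
  have "AE z in Q \<Otimes>\<^sub>M lborel. f z = indicator A z"
  proof (rule AE_pair_measure)
    show "{z \<in> space (Q \<Otimes>\<^sub>M lborel). f z = indicator A z} \<in> sets (Q \<Otimes>\<^sub>M lborel)"
      using f by measurable
    show "AE \<omega>' in Q. AE x in lborel. f (\<omega>', x) = indicator A (\<omega>', x)"
      using Zt AE_space
      by eventually_elim (simp add: f_def A_def closed_segment_eq_real_ivl \<open>0 \<le> t\<close> indicator_def)
  qed
  note f = f this
  have "has_gaussian_integral P (Q \<Otimes>\<^sub>M lborel) W f (segment_integral_process P Q W Z t)"
    unfolding segment_integral_process_def gaussian_integral_def f_def[symmetric]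
    by (rule someI[where P = "has_gaussian_integral P (Q \<Otimes>\<^sub>M lborel) W f"], rule has_gaussian_integral_indicator[OF assms(1) W A f])
  then show "segment_integral_process P Q W Z t \<in> borel_measurable P"
    and "AE \<omega> in P. segment_integral_process P Q W Z t \<omega> = W (space Q \<times> {0..t}) \<omega>"
    using has_gaussian_integral_indicator_unique[OF assms(1) W A f(2)]
    by (auto simp: A_def has_gaussian_integral_def)
qed

theorem proposition5p2:
  fixes P :: "'a measure" and P' :: "'b measure"
    and Y :: "real \<Rightarrow> 'b \<Rightarrow> real" and H \<sigma> :: real
    and M\<^sub>1 :: "('b \<times> real) set \<Rightarrow> 'a \<Rightarrow> real"
  assumes "prob_space P" and "prob_space P'"
    and "fractional_brownian_motion P' H \<sigma> Y"
    and "gaussian_random_measure P (P' \<Otimes>\<^sub>M lborel) M\<^sub>1"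
  shows "(\<forall>s\<ge>0. AE \<omega>' in P'. level_hitting_time Y s \<omega>' < \<infinity>) \<and>
    brownian_motion_fdd P
      (segment_integral_process P P' M\<^sub>1 (time_change Y (level_hitting_time Y)))"
proof
  note Y = assms(3)
  show "\<forall>s\<ge>0. AE \<omega>' in P'. level_hitting_time Y s \<omega>' < \<infinity>"
    unfolding level_hitting_time_finite_iff
    using fractional_brownian_motion_hits_level[OF assms(2) Y] by blast
  let ?Z = "time_change Y (level_hitting_time Y)"
  have Z: "?Z t \<omega>' = (if \<exists>r\<ge>0. Y r \<omega>' = t then t else 0)" if "\<omega>' \<in> space P'" for t \<omega>'
    using that fractional_brownian_motion_continuous[OF Y] fractional_brownian_motion_zero[OF Y]
    by (intro time_change_level_hitting_time) auto
  have Z_borel: "?Z t \<in> borel_measurable P'" if "0 \<le> t" for t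
  proof -
    have "(\<lambda>\<omega>'. if \<exists>r\<ge>0. Y r \<omega>' = t then t else 0) \<in> borel_measurable P'"
      using fractional_brownian_motion_hits_level_sets[OF Y that]
      by (intro measurable_If) auto
    then show ?thesis by (subst measurable_cong[OF Z])
  qed
  have Z_AE: "AE \<omega>' in P'. ?Z t \<omega>' = t" if "0 \<le> t" for t
    using fractional_brownian_motion_hits_level[OF assms(2) Y that] AE_space
    by eventually_elim (simp add: Z)
  show "brownian_motion_fdd P (segment_integral_process P P' M\<^sub>1 ?Z)"
    using segment_integral_process_AE_strip[OF assms(1,2,4)] Z_borel Z_AE
    by (intro brownian_motion_fdd_of_strips[OF assms(1,2,4)]) auto
qed

end
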